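(* Let $\{(X_n,d_n,\nu_n)\}_n$ be a Lévy family of metric measure spaces. Suppose there exist random walks $m_n:X_n\to\mathcal{P}_1(X_n)$, $x\mapsto (m_n)_x$, and a constant $\kappa_0\in\mathbb{R}$ such that $\kappa^{m_n}_1(x,y)\ge\kappa_0$ for all $n$ and all distinct $x,y\in X_n$. Then $\{(\mathcal{P}_1(X_n),W_1,(\tilde m_n)_{\nu_n})\}_n$ is also a Lévy family, where $(\tilde m_n)_{\nu_n}$ is the push-forward of $\nu_n$ under $x\mapsto (m_n)_x$.
   Context: A metric measure space $(X,d,\mu)$ is a complete separable metric space with a Borel probability measure. $\mathcal{P}_1(X)$ is the set of Borel probability measures with finite first moment, with the $L^1$-Wasserstein distance $W_1(\mu,\nu)=\inf_\pi\int d\,d\pi$ over couplings $\pi$ of $\mu,\nu$. The $1$-coarse Ricci curvature of a random walk $m$ is $\kappa^m_1(x,y)=1-W_1(m_x,m_y)/d(x,y)$. For a Borel probability measure $\mu$ on $\mathbb{R}$ and $\kappa\in(0,1)$, the partial diameter is $\mathrm{Diam}(\mu,1-\kappa)=\inf\{\mathrm{Diam}(A): A\subset\mathbb{R}\text{ Borel},\ \mu(A)\ge1-\kappa\}$. Set $\mathrm{ObsDiam}(X;-\kappa)=\sup\{\mathrm{Diam}(f_*\mu,1-\kappa): f:X\to\mathbb{R}\ 1\text{-Lipschitz}\}$ and $\mathrm{ObsDiam}(X)=\inf_{\kappa\in(0,1)}\max\{\mathrm{ObsDiam}(X;-\kappa),\kappa\}$. A sequence of metric measure spaces $X_n$ is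 a Lévy family if $\mathrm{ObsDiam}(X_n)\to0$. *)

theory Defs
  imports "HOL-Probability.Probability"
begin

definition borel_of :: "'a topology \<Rightarrow> 'a measure" where
  "borel_of T = sigma (topspace T) {U. openin T U}"

definition mm_space :: "'a set \<Rightarrow> ('a \<Rightarrow> 'a \<Rightarrow> real) \<Rightarrow> 'a measure \<Rightarrow> bool" where
  "mm_space S d \<mu> \<longleftrightarrow>
     Metric_space S d \<and> Metric_space.mcomplete S d \<and>
     separable_space (Metric_space.mtopology S d) \<and>
     space \<mu> = S \<and> sets \<mu> = sets (borel_of (Metric_space.mtopology S d)) \<and>
     prob_space \<mu>"

definition P1 :: "'a set \<Rightarrow> ('a \<Rightarrow> 'a \<Rightarrow> real) \<Rightarrow> 'a measure set" where
  "P1 S d = {\<mu>. space \<mu> = S \<and> sets \<mu> = sets (borel_of (Metric_space.mtopology S d)) \<and>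
               prob_space \<mu> \<and> (\<exists>x0\<in>S. integrable \<mu> (\<lambda>x. d x0 x))}"

definition couplings :: "'a measure \<Rightarrow> 'a measure \<Rightarrow> ('a \<times> 'a) measure set" where
  "couplings \<mu> \<nu> = {\<pi>. sets \<pi> = sets (\<mu> \<Otimes>\<^sub>M \<nu>) \<and> prob_space \<pi> \<and>
                       distr \<pi> \<mu> fst = \<mu> \<and> distr \<pi> \<nu> snd = \<nu>}"

definition W1 :: "('a \<Rightarrow> 'a \<Rightarrow> real) \<Rightarrow> 'a measure \<Rightarrow> 'a measure \<Rightarrow> real" where
  "W1 d \<mu> \<nu> = enn2real (INF \<pi> \<in> couplings \<mu> \<nu>. \<integral>\<^sup>+ p. ennreal (d (fst p) (snd p)) \<partial>\<pi>)"

definition P1_borel :: "'a set \<Rightarrow> ('a \<Rightarrow> 'a \<Rightarrow> real) \<Rightarrow> 'a measure measure" where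
  "P1_borel S d = borel_of (Metric_space.mtopology (P1 S d) (W1 d))"

definition random_walk :: "'a set \<Rightarrow> ('a \<Rightarrow> 'a \<Rightarrow> real) \<Rightarrow> 'a measure \<Rightarrow> ('a \<Rightarrow> 'a measure) \<Rightarrow> bool" where
  "random_walk S d \<nu> m \<longleftrightarrow> (\<forall>x\<in>S. m x \<in> P1 S d) \<and> m \<in> measurable \<nu> (P1_borel S d)"

definition coarse_ricci1 :: "('a \<Rightarrow> 'a \<Rightarrow> real) \<Rightarrow> ('a \<Rightarrow> 'a measure) \<Rightarrow> 'a \<Rightarrow> 'a \<Rightarrow> real" where
  "coarse_ricci1 d m x y = 1 - W1 d (m x) (m y) / d x y"

definition pushforward_walk :: "'a set \<Rightarrow> ('a \<Rightarrow> 'a \<Rightarrow> real) \<Rightarrow> 'a measure \<Rightarrow> ('a \<Rightarrow> 'a measure) \<Rightarrow> 'a measure measure" where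
  "pushforward_walk S d \<nu> m = distr \<nu> (P1_borel S d) m"

definition set_diam :: "real set \<Rightarrow> ereal" where
  "set_diam A = (SUP x\<in>A. SUP y\<in>A. ereal \<bar>x - y\<bar>)"

definition partial_diam :: "real measure \<Rightarrow> real \<Rightarrow> ereal" where
  "partial_diam \<mu> \<alpha> = (INF A \<in> {A. A \<in> sets borel \<and> measure \<mu> A \<ge> \<alpha>}. set_diam A)"

definition lip1_funs :: "'a set \<Rightarrow> ('a \<Rightarrow> 'a \<Rightarrow> real) \<Rightarrow> ('a \<Rightarrow> real) set" where
  "lip1_funs S d = {f. \<forall>x\<in>S. \<forall>y\<in>S. \<bar>f x - f y\<bar> \<le> d x y}"

definition obs_diam_kappa :: "'a set \<Rightarrow> ('a \<Rightarrow> 'a \<Rightarrow> real) \<Rightarrow> 'a measure \<Rightarrow> real \<Rightarrow> ereal" where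
  "obs_diam_kappa S d \<mu> \<kappa> = (SUP f \<in> lip1_funs S d. partial_diam (distr \<mu> borel f) (1 - \<kappa>))"

definition obs_diam :: "'a set \<Rightarrow> ('a \<Rightarrow> 'a \<Rightarrow> real) \<Rightarrow> 'a measure \<Rightarrow> ereal" where
  "obs_diam S d \<mu> = (INF \<kappa> \<in> {0<..<1}. max (obs_diam_kappa S d \<mu> \<kappa>) (ereal \<kappa>))"

definition levy_family :: "(nat \<Rightarrow> 'a set) \<Rightarrow> (nat \<Rightarrow> 'a \<Rightarrow> 'a \<Rightarrow> real) \<Rightarrow> (nat \<Rightarrow> 'a measure) \<Rightarrow> bool" where
  "levy_family S d \<mu> \<longleftrightarrow> (\<forall>n. mm_space (S n) (d n) (\<mu> n)) \<and>
     (\<lambda>n. obs_diam (S n) (d n) (\<mu> n)) \<longlonglongrightarrow> 0"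

end

theory Submission
  imports Defs
begin

text \<open>
  A lower curvature bound \<open>\<kappa>\<^sub>0\<close> says that \<open>x \<mapsto> m\<^sub>x\<close> is Lipschitz with constant \<open>C = max 1 (1 - \<kappa>\<^sub>0)\<close>
  from \<open>X\<close> to \<open>(P\<^sub>1(X), W\<^sub>1)\<close>. Pulling back 1-Lipschitz functions and rescaling by \<open>C\<close> gives
  \<open>ObsDiam (P\<^sub>1(X)) \<le> C ObsDiam X\<close>, and the limit follows.

  That \<open>(P\<^sub>1(X), W\<^sub>1)\<close> is a complete separable metric space has to be proved as well. Both the
  triangle inequality and completeness rest on gluing a sequence of couplings \<open>\<pi>\<^sub>n\<close> with matching
  marginals into one process. Instead of disintegrating \<open>\<pi>\<^sub>n\<^sub>+\<^sub>1\<close> exactly along its first marginal, one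
  conditions it on the cells of a countable partition into pieces of small diameter. These kernels
  are explicit, the Ionescu-Tulcea theorem yields the process, and the gluing error is the diameter of
  the pieces. For a fast Cauchy sequence in \<open>P\<^sub>1(X)\<close> the process converges almost surely, and the law
  of its limit is the limit in \<open>W\<^sub>1\<close>.
\<close>

section \<open>Chains of measures matched along a countable index\<close>

text \<open>Elementary conditioning on countably many cells takes the place of regular conditional
  distributions, whose kernels would have to be chosen measurably over an uncountable space. The
  price is paid in one place only. A coordinate of the process is a pair whose law is exactly
  \<open>\<pi> n\<close>, so transport costs stay exact; only the second half of one pair and the
  first half of the next may differ, by less than a bound prescribed for each n. The triangle
  inequality takes this bound constant and arbitrarily small, completeness takes the summable
  (1/2)^n.

  \<open>W1\<close> is real-valued through \<open>enn2real\<close>, which turns an infinite infimum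
  into 0. Hence finiteness of the cost between measures of finite first moment is secured before
  near-optimal couplings are picked; optimal couplings never occur.

  The lower bound 1 on C serves the second term of the maximum defining ObsDiam, where \<kappa>
  \<le> C \<kappa> is required.\<close>

definition cond_measure :: "'b measure \<Rightarrow> 'b set \<Rightarrow> 'b measure" where
  "cond_measure \<rho> B = (if emeasure \<rho> B = 0 then \<rho> else uniform_measure \<rho> B)"

lemma sets_cond_measure [simp]: "sets (cond_measure \<rho> B) = sets \<rho>"
  by (simp add: cond_measure_def)

lemma (in prob_space) prob_space_cond_measure: "prob_space (cond_measure M B)"
  unfolding cond_measure_def
  by (auto intro!: prob_space_uniform_measure prob_space_axioms)

text \<open>Multiplying by the mass of \<open>B\<close> clears the division, so the identity covers
  null cells too: there \<open>cond_measure\<close> defaults to the whole measure, which keeps it a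
  probability, and both sides vanish.\<close>

lemma (in prob_space) cond_measure_mult:
  assumes "B \<in> sets M" "A \<in> sets M"
  shows "emeasure (cond_measure M B) A * emeasure M B = emeasure M (A \<inter> B)"
proof (cases "emeasure M B = 0")
  case True
  then show ?thesis
    using assms emeasure_mono[of "A \<inter> B" B M] by (simp add: cond_measure_def)
next
  case False
  then show ?thesis
    using assms by (simp add: cond_measure_def Int_commute ennreal_divide_times
        ennreal_divide_self less_top[symmetric])
qed

lemma nn_integral_nat_valued:
  fixes a :: "'b \<Rightarrow> nat"
  assumes a[measurable]: "a \<in> \<rho> \<rightarrow>\<^sub>M count_space UNIV"
  shows "(\<integral>\<^sup>+x. h (a x) \<partial>\<rho>) = (\<Sum>i. h i * emeasure \<rho> {x \<in> space \<rho>. a x = i})"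
proof -
  have "(\<integral>\<^sup>+x. h (a x) \<partial>\<rho>) = (\<integral>\<^sup>+x. (\<Sum>i. h i * indicator {x \<in> space \<rho>. a x = i} x) \<partial>\<rho>)"
  proof (rule nn_integral_cong)
    fix x assume "x \<in> space \<rho>"
    then have "(\<Sum>i. h i * indicator {x \<in> space \<rho>. a x = i} x) =
        (\<Sum>i\<in>{a x}. h i * indicator {x \<in> space \<rho>. a x = i} x)"
      by (intro suminf_finite) (auto simp: indicator_def)
    with \<open>x \<in> space \<rho>\<close> show "h (a x) = (\<Sum>i. h i * indicator {x \<in> space \<rho>. a x = i} x)"
      by simp
  qed
  also have "\<dots> = (\<Sum>i. \<integral>\<^sup>+x. h i * indicator {x \<in> space \<rho>. a x = i} x \<partial>\<rho>)"
    by (rule nn_integral_suminf) measurable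
  also have "\<dots> = (\<Sum>i. h i * emeasure \<rho> {x \<in> space \<rho>. a x = i})"
    by (intro suminf_cong nn_integral_cmult_indicator) measurable
  finally show ?thesis .
qed

text \<open>Only the law of the index enters. This lets an average over the current coordinate be
  computed with the cell masses of the next measure, the weights for which the conditional measures
  recombine.\<close>

lemma nn_integral_nat_valued_cong:
  fixes a b :: "_ \<Rightarrow> nat"
  assumes [measurable]: "b \<in> \<pi> \<rightarrow>\<^sub>M count_space UNIV" "a \<in> \<rho> \<rightarrow>\<^sub>M count_space UNIV"
    and match: "distr \<pi> (count_space UNIV) b = distr \<rho> (count_space UNIV) a"
  shows "(\<integral>\<^sup>+x. h (b x) \<partial>\<pi>) = (\<Sum>i. h i * emeasure \<rho> {x \<in> space \<rho>. a x = i})"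
proof -
  have "(\<integral>\<^sup>+x. h (b x) \<partial>\<pi>) = (\<integral>\<^sup>+i. h i \<partial>distr \<pi> (count_space UNIV) b)"
    by (simp add: nn_integral_distr)
  also have "\<dots> = (\<integral>\<^sup>+x. h (a x) \<partial>\<rho>)"
    unfolding match by (simp add: nn_integral_distr)
  finally show ?thesis by (simp add: nn_integral_nat_valued)
qed

lemma (in prob_space) cond_measure_total:
  fixes a :: "'a \<Rightarrow> nat"
  assumes [measurable]: "a \<in> M \<rightarrow>\<^sub>M count_space UNIV" "A \<in> sets M"
  shows "(\<Sum>i. emeasure (cond_measure M {x \<in> space M. a x = i}) A *
            emeasure M {x \<in> space M. a x = i}) = emeasure M A"
proof -
  have "(\<Sum>i. emeasure M (A \<inter> {x \<in> space M. a x = i})) = emeasure M (\<Union>i. A \<inter> {x \<in> space M. a x = i})"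
    by (rule suminf_emeasure) (auto simp: disjoint_family_on_def)
  also have "(\<Union>i. A \<inter> {x \<in> space M. a x = i}) = A"
    using sets.sets_into_space[OF assms(2)] by auto
  finally show ?thesis by (simp add: cond_measure_mult)
qed

text \<open>A non-null cell carries all of its conditional measure, and a null cell has weight 0; in
  the average over cells no mass leaves its cell.\<close>

lemma (in prob_space) cond_measure_complement:
  assumes [measurable]: "B \<in> sets M"
  shows "emeasure (cond_measure M B) (space M - B) * emeasure M B = 0"
proof -
  have *: "(space M - B) \<inter> B = {}" by auto
  show ?thesis
    by (subst cond_measure_mult) (simp_all add: *)
qed

text \<open>Given \<open>\<omega> n\<close>, the next coordinate is drawn from
  \<open>\<pi> (Suc n)\<close> conditioned on the cell of \<open>a n\<close> whose index is
  \<open>b n (\<omega> n)\<close>. Since both indices have the same law, averaging these kernels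
  gives back \<open>\<pi> (Suc n)\<close> by total probability, and by construction the two indices
  agree almost surely.\<close>

lemma exists_nat_matched_chain:
  fixes \<pi> :: "nat \<Rightarrow> 'b measure" and M :: "'b measure" and a b :: "nat \<Rightarrow> 'b \<Rightarrow> nat"
  assumes sets_\<pi>: "\<And>n. sets (\<pi> n) = sets M" and prob: "\<And>n. prob_space (\<pi> n)"
    and b[measurable]: "\<And>n. b n \<in> M \<rightarrow>\<^sub>M count_space UNIV"
    and a[measurable]: "\<And>n. a n \<in> M \<rightarrow>\<^sub>M count_space UNIV"
    and match: "\<And>n. distr (\<pi> n) (count_space UNIV) (b n) =
                     distr (\<pi> (Suc n)) (count_space UNIV) (a n)"
  shows "\<exists>L. prob_space L \<and> sets L = sets (PiM UNIV (\<lambda>_. M)) \<and>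
             (\<forall>n. distr L M (\<lambda>\<omega>. \<omega> n) = \<pi> n) \<and>
             (\<forall>n. AE \<omega> in L. b n (\<omega> n) = a n (\<omega> (Suc n)))"
proof -
  have sp: "space (\<pi> n) = space M" for n
    using sets_\<pi> by (rule sets_eq_imp_space_eq)
  define K where "K n i = cond_measure (\<pi> (Suc n)) {x \<in> space M. a n x = i}" for n i
  define P where "P n \<omega> = (case n of 0 \<Rightarrow> \<pi> 0 | Suc k \<Rightarrow> K k (b k (\<omega> k)))" for n \<omega>
  have pK: "prob_space (K n i)" for n i
    unfolding K_def by (rule prob_space.prob_space_cond_measure[OF prob])
  have sK: "sets (K n i) = sets M" for n i
    by (simp add: K_def sets_\<pi>)
  \<comment> \<open>The parameter of the kernel is a natural number, so its measurability is
    automatic; this is what discretising the condition buys.\<close>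
  have mK[measurable]: "K n \<in> count_space UNIV \<rightarrow>\<^sub>M subprob_algebra M" for n
    by (auto simp: space_subprob_algebra sK intro: pK prob_space_imp_subprob_space)
  interpret IT: Ionescu_Tulcea P "\<lambda>_. M"
  proof (rule Ionescu_Tulcea.intro)
    show "P i \<in> Pi\<^sub>M {0..<i} (\<lambda>_. M) \<rightarrow>\<^sub>M subprob_algebra M" for i
    proof (cases i)
      case 0
      have "\<pi> 0 \<in> space (subprob_algebra M)"
        by (simp add: space_subprob_algebra sets_\<pi> prob prob_space_imp_subprob_space)
      with 0 show ?thesis by (simp add: P_def[abs_def])
    next
      case (Suc k)
      then have "k \<in> {0..<i}" by simp
      then have [measurable]: "(\<lambda>\<omega>. \<omega> k) \<in> Pi\<^sub>M {0..<i} (\<lambda>_. M) \<rightarrow>\<^sub>M M"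
        by (rule measurable_component_singleton)
      show ?thesis unfolding P_def[abs_def] Suc nat.case
        using Suc by measurable
    qed
    fix i :: nat and x :: "nat \<Rightarrow> 'b" assume "x \<in> space (PiM {0..<i} (\<lambda>_. M))"
    show "prob_space (P i x)"
      by (auto simp: P_def prob pK split: nat.split)
  qed
  define L where "L = IT.PF.lim"
  have setsL: "sets L = sets (PiM UNIV (\<lambda>_. M))"
    unfolding L_def by (rule IT.PF.sets_lim)
  \<comment> \<open>Law of the first n coordinates, started from the only point of the empty
    product.\<close>
  define C where "C n = IT.C 0 n (\<lambda>_. undefined)" for n
  have und: "(\<lambda>_. undefined) \<in> space (PiM {0..<0::nat} (\<lambda>_. M))"
    by (simp add: space_PiM)
  have setsC: "sets (C n) = sets (PiM {0..<n} (\<lambda>_. M))" for n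
    unfolding C_def using IT.sets_C[OF und, of n] by simp
  have spaceC: "space (C n) = space (PiM {0..<n} (\<lambda>_. M))" for n
    using setsC by (rule sets_eq_imp_space_eq)
  have distrL: "distr L (PiM {0..<n} (\<lambda>_. M)) (\<lambda>\<omega>. restrict \<omega> {0..<n}) = C n" for n
  proof -
    \<comment> \<open>The projective family is built from laws of initial segments cut at
      \<open>up_to\<close>; for the segment \<open>{0..<n}\<close> the cut is n itself, which
      identifies its member with \<open>C n\<close>.\<close>
    have "IT.up_to {0..<n} \<le> n" by (subst IT.up_to_iff_Ico) auto
    moreover have "n \<le> IT.up_to {0..<n}"
    proof (rule ccontr)
      assume "\<not> n \<le> IT.up_to {0..<n}"
      then have "IT.up_to {0..<n} \<in> {0..<n}" by simp
      from IT.up_to_less[OF _ this] show False by simp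
    qed
    ultimately have "IT.up_to {0..<n} = n" by simp
    then have "IT.CI {0..<n} = C n"
      using IT.distr_C[of n n "\<lambda>_. undefined" 0, OF _ und] by (simp add: IT.CI_def C_def)
    then show ?thesis
      unfolding L_def using IT.distr_lim[of "{0..<n}"] by simp
  qed
  interpret L: prob_space L
  proof -
    \<comment> \<open>The total mass of \<open>L\<close> is read off from its projection to the
      empty product.\<close>
    have "prob_space (distr L (PiM {0..<0} (\<lambda>_. M)) (\<lambda>\<omega>. restrict \<omega> {0..<0}))"
      unfolding distrL C_def by (rule IT.prob_space_C[OF und])
    then show "prob_space L"
      by (rule prob_space_distrD[rotated]) (simp add: measurable_cong_sets[OF setsL refl] measurable_restrict_subset)
  qed
  have ev: "(\<lambda>\<omega>. \<omega> k) \<in> PiM {0..<n} (\<lambda>_. M) \<rightarrow>\<^sub>M M" if "k < n" for k n :: nat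
    by (rule measurable_component_singleton) (use that in auto)
  have evL[measurable]: "(\<lambda>\<omega>. \<omega> k) \<in> L \<rightarrow>\<^sub>M M" for k
    by (simp add: measurable_cong_sets[OF setsL refl])
  have emL: "emeasure (distr L M (\<lambda>\<omega>. \<omega> k)) A = (\<integral>\<^sup>+\<omega>. indicator A (\<omega> k) \<partial>L)"
    if [measurable]: "A \<in> sets M" for A k
    by (subst nn_integral_indicator[symmetric])
      (simp_all add: nn_integral_distr del: nn_integral_indicator)
  have res: "(\<lambda>\<omega>. restrict \<omega> {0..<n}) \<in> L \<rightarrow>\<^sub>M PiM {0..<n} (\<lambda>_. M)" for n
    by (simp add: measurable_cong_sets[OF setsL refl] measurable_restrict_subset)
  have intL: "(\<integral>\<^sup>+\<omega>. f (restrict \<omega> {0..<n}) \<partial>L) = (\<integral>\<^sup>+\<omega>. f \<omega> \<partial>C n)"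
    if "f \<in> borel_measurable (PiM {0..<n} (\<lambda>_. M))" for f n
    unfolding distrL[symmetric] using that res by (subst nn_integral_distr) auto
  have intC: "(\<integral>\<^sup>+\<omega>. f \<omega> \<partial>C (Suc n)) = (\<integral>\<^sup>+\<omega>. \<integral>\<^sup>+x. f (fun_upd \<omega> n x) \<partial>P n \<omega> \<partial>C n)"
    if f: "f \<in> borel_measurable (PiM {0..<Suc n} (\<lambda>_. M))" for f n
  proof -
    have eP: "IT.eP n \<in> C n \<rightarrow>\<^sub>M subprob_algebra (PiM {0..<Suc n} (\<lambda>_. M))"
      using IT.measurable_eP[of n] by (simp add: measurable_cong_sets[OF setsC refl])
    have "C (Suc n) = C n \<bind> IT.eP n" by (simp add: C_def)
    then show ?thesis
      using nn_integral_bind[OF f eP] f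
      by (auto intro!: nn_integral_cong IT.nn_integral_eP simp: spaceC)
  qed
  \<comment> \<open>The Markov property in integrated form: unfold one transition on the finite
    segment, then return to \<open>L\<close>. The marginal laws and the agreement of indices are
    both instances.\<close>
  have step: "(\<integral>\<^sup>+\<omega>. g (\<omega> n) (\<omega> (Suc n)) \<partial>L) = (\<integral>\<^sup>+\<omega>. \<integral>\<^sup>+x. g (\<omega> n) x \<partial>K n (b n (\<omega> n)) \<partial>L)"
    if g: "(\<lambda>(x, y). g x y) \<in> borel_measurable (M \<Otimes>\<^sub>M M)" for g n
  proof -
    have g1: "(\<lambda>\<omega>. g (\<omega> n) (\<omega> (Suc n))) \<in> borel_measurable (PiM {0..<Suc (Suc n)} (\<lambda>_. M))"
    proof -
      have "(\<lambda>\<omega>. (\<omega> n, \<omega> (Suc n))) \<in> PiM {0..<Suc (Suc n)} (\<lambda>_. M) \<rightarrow>\<^sub>M M \<Otimes>\<^sub>M M"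
        by (intro measurable_Pair ev) auto
      from measurable_compose[OF this g] show ?thesis by simp
    qed
    have g2: "(\<lambda>x. \<integral>\<^sup>+y. g x y \<partial>K n (b n x)) \<in> borel_measurable M"
      by (rule nn_integral_measurable_subprob_algebra2[where N = M]) (use g in \<open>measurable\<close>)
    have "(\<integral>\<^sup>+\<omega>. g (\<omega> n) (\<omega> (Suc n)) \<partial>L) = (\<integral>\<^sup>+\<omega>. g (\<omega> n) (\<omega> (Suc n)) \<partial>C (Suc (Suc n)))"
      using intL[OF g1] by simp
    also have "\<dots> = (\<integral>\<^sup>+\<omega>. \<integral>\<^sup>+x. g (\<omega> n) x \<partial>K n (b n (\<omega> n)) \<partial>C (Suc n))"
      using intC[OF g1] by (simp add: P_def)
    also have "\<dots> = (\<integral>\<^sup>+\<omega>. \<integral>\<^sup>+x. g (\<omega> n) x \<partial>K n (b n (\<omega> n)) \<partial>L)"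
      using intL[OF measurable_compose[OF ev g2], of n "Suc n"] by simp
    finally show ?thesis .
  qed
  have law: "distr L M (\<lambda>\<omega>. \<omega> n) = \<pi> n" for n
  proof (induction n)
    case 0
    show ?case
    proof (rule measure_eqI)
      fix A assume "A \<in> sets (distr L M (\<lambda>\<omega>. \<omega> 0))"
      then have A[measurable]: "A \<in> sets M" by simp
      have "(\<lambda>\<omega>. indicator A (\<omega> 0) :: ennreal) \<in> borel_measurable (PiM {0..<Suc 0} (\<lambda>_. M))"
        using ev[of 0 "Suc 0"] A by measurable
      from intL[OF this] intC[OF this]
      have "(\<integral>\<^sup>+\<omega>. indicator A (\<omega> 0) \<partial>L) = (\<integral>\<^sup>+\<omega>. emeasure (\<pi> 0) A \<partial>C 0)"
        by (simp add: P_def sets_\<pi>)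
      also have "\<dots> = emeasure (\<pi> 0) A"
        using prob_space.emeasure_space_1[OF IT.prob_space_C[OF und, of 0]] by (simp add: C_def)
      finally show "emeasure (distr L M (\<lambda>\<omega>. \<omega> 0)) A = emeasure (\<pi> 0) A"
        by (simp only: emL[OF A])
    qed (simp add: sets_\<pi>)
  next
    case (Suc n)
    interpret p: prob_space "\<pi> (Suc n)" by (rule prob)
    show ?case
    proof (rule measure_eqI)
      fix A assume "A \<in> sets (distr L M (\<lambda>\<omega>. \<omega> (Suc n)))"
      then have A[measurable]: "A \<in> sets M" by simp
      have "(\<integral>\<^sup>+\<omega>. indicator A (\<omega> (Suc n)) \<partial>L) = (\<integral>\<^sup>+\<omega>. \<integral>\<^sup>+x. indicator A x \<partial>K n (b n (\<omega> n)) \<partial>L)"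
        by (rule step) measurable
      also have "\<dots> = (\<integral>\<^sup>+\<omega>. emeasure (K n (b n (\<omega> n))) A \<partial>L)"
        by (simp add: sK)
      also have "\<dots> = (\<integral>\<^sup>+x. emeasure (K n (b n x)) A \<partial>distr L M (\<lambda>\<omega>. \<omega> n))"
        by (subst nn_integral_distr) (auto intro!: measurable_compose[OF b] )
      also have "\<dots> = (\<Sum>i. emeasure (K n i) A * emeasure (\<pi> (Suc n)) {x \<in> space (\<pi> (Suc n)). a n x = i})"
        unfolding Suc.IH by (rule nn_integral_nat_valued_cong[OF _ _ match])
          (simp_all add: measurable_cong_sets[OF sets_\<pi> refl])
      also have "\<dots> = emeasure (\<pi> (Suc n)) A"
        unfolding K_def sp[symmetric, of "Suc n"] by (rule p.cond_measure_total)
          (simp_all add: measurable_cong_sets[OF sets_\<pi> refl] sets_\<pi>)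
      finally show "emeasure (distr L M (\<lambda>\<omega>. \<omega> (Suc n))) A = emeasure (\<pi> (Suc n)) A"
        by (simp only: emL[OF A])
    qed (simp add: sets_\<pi>)
  qed
  have "AE \<omega> in L. b n (\<omega> n) = a n (\<omega> (Suc n))" for n
  proof -
    interpret p: prob_space "\<pi> (Suc n)" by (rule prob)
    let ?g = "\<lambda>x y. if b n x \<noteq> a n y then 1 else 0 :: ennreal"
    \<comment> \<open>Equality of two indices is written as a countable union over the common
      value.\<close>
    have "Measurable.pred (M \<Otimes>\<^sub>M M) (\<lambda>p. \<exists>i. b n (fst p) = i \<and> a n (snd p) = i)"
      by measurable
    then have pred_eq: "Measurable.pred (M \<Otimes>\<^sub>M M) (\<lambda>p. b n (fst p) = a n (snd p))"
      by (simp add: eq_commute)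
    have mg: "(\<lambda>(x, y). ?g x y) \<in> borel_measurable (M \<Otimes>\<^sub>M M)"
      unfolding split_beta' by (rule measurable_If) (use pred_eq in simp_all)
    have mgL: "(\<lambda>\<omega>. ?g (\<omega> n) (\<omega> (Suc n))) \<in> borel_measurable L"
      using measurable_compose[OF measurable_Pair[OF evL[of n] evL[of "Suc n"]] mg] by simp
    let ?N = "\<lambda>i. {x \<in> space M. a n x \<noteq> i}"
    have eq: "(\<integral>\<^sup>+x. (if i \<noteq> a n x then 1 else 0) \<partial>K n i) = emeasure (K n i) (?N i)" for i
    proof -
      have "(\<integral>\<^sup>+x. (if i \<noteq> a n x then 1 else 0) \<partial>K n i) = (\<integral>\<^sup>+x. indicator (?N i) x \<partial>K n i)"
        by (intro nn_integral_cong) (auto simp: indicator_def sets_eq_imp_space_eq[OF sK])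
      also have "\<dots> = emeasure (K n i) (?N i)"
        by (rule nn_integral_indicator) (simp add: sK)
      finally show ?thesis .
    qed
    have "(\<integral>\<^sup>+\<omega>. ?g (\<omega> n) (\<omega> (Suc n)) \<partial>L) = (\<integral>\<^sup>+\<omega>. \<integral>\<^sup>+x. ?g (\<omega> n) x \<partial>K n (b n (\<omega> n)) \<partial>L)"
      by (rule step[OF mg])
    also have "\<dots> = (\<integral>\<^sup>+\<omega>. emeasure (K n (b n (\<omega> n))) (?N (b n (\<omega> n))) \<partial>L)"
      by (simp add: eq)
    also have "\<dots> = (\<integral>\<^sup>+x. emeasure (K n (b n x)) (?N (b n x)) \<partial>distr L M (\<lambda>\<omega>. \<omega> n))"
      by (subst nn_integral_distr) (auto intro!: measurable_compose[OF b])
    also have "\<dots> = (\<Sum>i. emeasure (K n i) (?N i) * emeasure (\<pi> (Suc n)) {x \<in> space (\<pi> (Suc n)). a n x = i})"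
      unfolding law by (rule nn_integral_nat_valued_cong[OF _ _ match])
        (simp_all add: measurable_cong_sets[OF sets_\<pi> refl])
    also have "\<dots> = 0"
    proof -
      have N: "space M - {x \<in> space M. a n x = i} = ?N i" for i
        by auto
      have "emeasure (K n i) (?N i) * emeasure (\<pi> (Suc n)) {x \<in> space M. a n x = i} = 0" for i
        using p.cond_measure_complement[of "{x \<in> space M. a n x = i}"]
        unfolding K_def sp N by (simp add: sets_\<pi>)
      then show ?thesis
        by (simp only: sp suminf_zero)
    qed
    finally have "AE \<omega> in L. ?g (\<omega> n) (\<omega> (Suc n)) = 0"
      by (subst (asm) nn_integral_0_iff_AE[OF mgL])
    then show ?thesis by eventually_elim (simp split: if_splits)
  qed
  with L.prob_space_axioms setsL law show ?thesis by blast
qed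

section \<open>Borel sets of separable metric spaces\<close>

lemma space_borel_of [simp]: "space (borel_of T) = topspace T"
  unfolding borel_of_def by (rule space_measure_of) (auto dest: openin_subset)

lemma sets_borel_of: "sets (borel_of T) = sigma_sets (topspace T) {U. openin T U}"
  unfolding borel_of_def by (rule sets_measure_of) (auto dest: openin_subset)

lemma borel_of_open: "openin T U \<Longrightarrow> U \<in> sets (borel_of T)"
  by (simp add: sets_borel_of)

lemma borel_of_closed:
  assumes "closedin T F" shows "F \<in> sets (borel_of T)"
proof -
  have "topspace T - (topspace T - F) \<in> sets (borel_of T)"
    using borel_of_open[of T "topspace T - F"] assms sets.compl_sets[of "topspace T - F" "borel_of T"]
    by (simp add: closedin_def)
  then show ?thesis
    using closedin_subset[OF assms] by (simp add: double_diff)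
qed

lemma continuous_map_borel_of:
  assumes "continuous_map T euclidean f"
  shows "f \<in> borel_of T \<rightarrow>\<^sub>M borel"
proof (rule borel_measurableI)
  fix U :: "'b set" assume "open U"
  then have "openin T {x \<in> topspace T. f x \<in> U}"
    using assms by (simp add: continuous_map_def)
  moreover have "f -` U \<inter> space (borel_of T) = {x \<in> topspace T. f x \<in> U}"
    by auto
  ultimately show "f -` U \<inter> space (borel_of T) \<in> sets (borel_of T)"
    by (simp add: borel_of_open)
qed

lemma (in Metric_space) lipschitz_borel_measurable:
  fixes f :: "'a \<Rightarrow> real"
  assumes "\<And>x y. x \<in> M \<Longrightarrow> y \<in> M \<Longrightarrow> \<bar>f x - f y\<bar> \<le> C * d x y"
  shows "f \<in> borel_of mtopology \<rightarrow>\<^sub>M borel"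
proof (rule continuous_map_borel_of)
  have "continuous_map mtopology Met_TC.mtopology f"
    unfolding metric_continuous_map[OF Met_TC.Metric_space_axioms]
  proof (intro conjI ballI allI impI)
    show "f ` M \<subseteq> UNIV" by simp
  next
    fix a and \<epsilon> :: real assume a: "a \<in> M" "0 < \<epsilon>"
    show "\<exists>\<delta>>0. \<forall>x. x \<in> M \<and> d a x < \<delta> \<longrightarrow> dist (f a) (f x) < \<epsilon>"
    proof (intro exI conjI allI impI)
      \<comment> \<open>No sign of \<open>C\<close> is known, hence the denominator
        \<open>\<bar>C\<bar> + 1\<close>.\<close>
      show "0 < \<epsilon> / (\<bar>C\<bar> + 1)" using a by simp
      fix x assume x: "x \<in> M \<and> d a x < \<epsilon> / (\<bar>C\<bar> + 1)"
      have "\<bar>f a - f x\<bar> \<le> C * d a x" using assms a x by simp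
      also have "\<dots> \<le> (\<bar>C\<bar> + 1) * d a x" by (intro mult_right_mono) auto
      also have "\<dots> < \<epsilon>" using x by (simp add: pos_less_divide_eq mult.commute)
      finally show "dist (f a) (f x) < \<epsilon>" by (simp add: dist_real_def)
    qed
  qed
  then show "continuous_map mtopology euclidean f" by simp
qed

locale separable_Metric_space = Metric_space S d for S :: "'a set" and d +
  assumes separable: "separable_space mtopology"
begin

abbreviation \<B> :: "'a measure" where "\<B> \<equiv> borel_of mtopology"

lemma dist_measurable1: "c \<in> S \<Longrightarrow> (\<lambda>x. d c x) \<in> borel_measurable \<B>"
proof (rule lipschitz_borel_measurable[where C = 1])
  fix x y assume "c \<in> S" "x \<in> S" "y \<in> S"
  then show "\<bar>d c x - d c y\<bar> \<le> 1 * d x y"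
    using mdist_reverse_triangle[of x c y] by (simp add: commute)
qed

lemma exists_dense_seq:
  assumes "S \<noteq> {}"
  obtains q :: "nat \<Rightarrow> 'a" where "\<And>i. q i \<in> S" "\<And>x e. x \<in> S \<Longrightarrow> e > 0 \<Longrightarrow> \<exists>i. d (q i) x < e"
proof -
  obtain C where C: "countable C" "C \<subseteq> S" "mtopology closure_of C = S"
    using separable by (auto simp: separable_space_def)
  then have "C \<noteq> {}" using assms by auto
  have "\<exists>i. d (from_nat_into C i) x < e" if x: "x \<in> S" "e > 0" for x e
  proof -
    have "x \<in> mtopology closure_of C" using C(3) x by simp
    then obtain y where "y \<in> C" "d x y < e"
      using x(2) unfolding metric_closure_of by auto
    moreover obtain i where "from_nat_into C i = y"
      using from_nat_into_surj[OF C(1) \<open>y \<in> C\<close>] by auto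
    ultimately show ?thesis by (auto simp: commute)
  qed
  then show ?thesis
    using C from_nat_into[OF \<open>C \<noteq> {}\<close>] by (intro that[of "from_nat_into C"]) auto
qed

text \<open>By separability an open set is a countable union of balls with centres
  \<open>q i\<close> and radii 1/(n+1), and the preimage of a ball is a sublevel set of a distance
  function. The criterion suits limits of random points, whose distances to a fixed point are limits
  of real functions.\<close>

lemma measurable_borel_ofI_dist:
  assumes N: "f \<in> space N \<rightarrow> S" and f: "\<And>c. c \<in> S \<Longrightarrow> (\<lambda>\<omega>. d c (f \<omega>)) \<in> borel_measurable N"
  shows "f \<in> N \<rightarrow>\<^sub>M \<B>"
  unfolding borel_of_def
proof (rule measurable_measure_of)
  show "{U. openin mtopology U} \<subseteq> Pow (topspace mtopology)"
    by (auto dest!: openin_subset)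
  show "f \<in> space N \<rightarrow> topspace mtopology" using N by simp
  fix U assume "U \<in> {U. openin mtopology U}"
  then have U: "openin mtopology U" by simp
  show "f -` U \<inter> space N \<in> sets N"
  proof (cases "S = {}")
    case True
    then have "U = {}" using openin_subset[OF U] unfolding topspace_mtopology by simp
    then show ?thesis by simp
  next
    case False
    obtain q :: "nat \<Rightarrow> 'a" where q: "\<And>i. q i \<in> S" "\<And>x e. x \<in> S \<Longrightarrow> e > 0 \<Longrightarrow> \<exists>i. d (q i) x < e"
      using exists_dense_seq[OF False] by blast
    define I where "I = {p::nat \<times> nat. mball (q (fst p)) (1 / Suc (snd p)) \<subseteq> U}"
    have "U = (\<Union>p\<in>I. mball (q (fst p)) (1 / Suc (snd p)))"
    proof (intro equalityI subsetI)
      fix x assume x: "x \<in> U"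
      then obtain r where r: "r > 0" "mball x r \<subseteq> U" "x \<in> S"
        using U unfolding openin_mtopology by blast
      obtain n where n: "1 / Suc n < r / 2"
        using nat_approx_posE[of "r/2"] r(1) by auto
      obtain i where i: "d (q i) x < 1 / Suc n"
        using q(2)[OF r(3), of "1 / Suc n"] by auto
      have "mball (q i) (1 / Suc n) \<subseteq> mball x r"
      proof (rule mball_subset)
        show "d (q i) x + 1 / Suc n \<le> r" using i n by linarith
      qed (use r in auto)
      then have "(i, n) \<in> I" using r(2) by (auto simp: I_def)
      moreover have "x \<in> mball (q i) (1 / Suc n)" using i q(1) r(3) by auto
      ultimately show "x \<in> (\<Union>p\<in>I. mball (q (fst p)) (1 / Suc (snd p)))" by force
    qed (auto simp: I_def)
    then have "f -` U \<inter> space N = (\<Union>p\<in>I. {\<omega> \<in> space N. d (q (fst p)) (f \<omega>) < 1 / Suc (snd p)})"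
      using N q(1) by (auto simp: mball_def Pi_iff)
    moreover have "{\<omega> \<in> space N. d (q (fst p)) (f \<omega>) < 1 / Suc (snd p)} \<in> sets N" for p
      using f[of "q (fst p)"] q(1) by (intro borel_measurable_less) auto
    ultimately show ?thesis
      by (auto intro!: sets.countable_UN')
  qed
qed

text \<open>Couplings live on the product of the Borel sigma-algebras, so continuity on the product
  space does not settle the claim directly. Instead d(x, y) < r holds iff d(z, x) + d(z, y) < r for
  some z in a dense sequence, a countable union of sets measurable in the product.\<close>

lemma dist_measurable [measurable]: "(\<lambda>p. d (fst p) (snd p)) \<in> borel_measurable (\<B> \<Otimes>\<^sub>M \<B>)"
proof (cases "S = {}")
  case True
  have "space (\<B> \<Otimes>\<^sub>M \<B>) = {}"
    unfolding space_pair_measure space_borel_of topspace_mtopology using True by simp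
  then show ?thesis by (simp add: measurable_def)
next
  case False
  obtain q :: "nat \<Rightarrow> 'a" where q: "\<And>i. q i \<in> S" "\<And>x e. x \<in> S \<Longrightarrow> e > 0 \<Longrightarrow> \<exists>i. d (q i) x < e"
    using exists_dense_seq[OF False] by blast
  have [measurable]: "(\<lambda>x. d (q i) x) \<in> borel_measurable \<B>" for i
    using q(1) by (intro dist_measurable1) auto
  show ?thesis
  proof (rule borel_measurableI_less)
    fix r :: real
    have eq: "{p \<in> space (\<B> \<Otimes>\<^sub>M \<B>). d (fst p) (snd p) < r} =
        {p \<in> space (\<B> \<Otimes>\<^sub>M \<B>). \<exists>i. d (q i) (fst p) + d (q i) (snd p) < r}" (is "?A = ?B")
    proof (intro equalityI subsetI)
      fix p assume p: "p \<in> ?A"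
      then have S: "fst p \<in> S" "snd p \<in> S" and less: "d (fst p) (snd p) < r"
        by (auto simp: space_pair_measure)
      obtain i where i: "d (q i) (fst p) < (r - d (fst p) (snd p)) / 2"
        using q(2)[OF S(1), of "(r - d (fst p) (snd p)) / 2"] less by auto
      have "d (q i) (snd p) \<le> d (q i) (fst p) + d (fst p) (snd p)"
        using triangle[of "q i" "fst p" "snd p"] q(1) S by auto
      then have "d (q i) (fst p) + d (q i) (snd p) < r" using i by (simp add: field_simps)
      then show "p \<in> ?B" using p by auto
    next
      fix p assume p: "p \<in> ?B"
      then obtain i where i: "d (q i) (fst p) + d (q i) (snd p) < r" by auto
      have "d (fst p) (snd p) \<le> d (q i) (fst p) + d (q i) (snd p)"
        using triangle''[of "fst p" "q i" "snd p"] q(1) p by (auto simp: space_pair_measure)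
      then show "p \<in> ?A" using i p by auto
    qed
    show "{p \<in> space (\<B> \<Otimes>\<^sub>M \<B>). d (fst p) (snd p) < r} \<in> sets (\<B> \<Otimes>\<^sub>M \<B>)"
      unfolding eq by measurable
  qed
qed

lemma dist_measurable_comp [measurable (raw)]:
  assumes "f \<in> N \<rightarrow>\<^sub>M \<B>" "g \<in> N \<rightarrow>\<^sub>M \<B>"
  shows "(\<lambda>x. d (f x) (g x)) \<in> borel_measurable N"
  using measurable_compose[OF measurable_Pair[OF assms] dist_measurable] by simp

text \<open>The index of a point is the first member of the dense sequence within distance
  \<open>e\<close>. The sequence is an argument, since separability of \<open>P1\<close> requires
  the same points \<open>q i\<close> for all measures and all \<open>e\<close>.\<close>

lemma exists_countable_partition:
  assumes "e > 0" and q: "\<And>i. q i \<in> S" "\<And>x e. x \<in> S \<Longrightarrow> e > 0 \<Longrightarrow> \<exists>i. d (q i) x < e"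
  shows "\<exists>idx::'a \<Rightarrow> nat. idx \<in> \<B> \<rightarrow>\<^sub>M count_space UNIV \<and> (\<forall>x\<in>S. d (q (idx x)) x < e)"
proof (intro exI conjI ballI)
  let ?idx = "\<lambda>x. LEAST i. d (q i) x < e"
  have [measurable]: "(\<lambda>x. d (q i) x) \<in> borel_measurable \<B>" for i
    using q(1) by (intro dist_measurable1) auto
  show "?idx \<in> \<B> \<rightarrow>\<^sub>M count_space UNIV"
    by measurable
  show "d (q (?idx x)) x < e" if "x \<in> S" for x
    using q(2)[OF that \<open>e > 0\<close>] by (rule LeastI_ex)
qed

lemma exists_index:
  assumes "S \<noteq> {}" "e > 0"
  shows "\<exists>idx::'a \<Rightarrow> nat. idx \<in> \<B> \<rightarrow>\<^sub>M count_space UNIV \<and>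
           (\<forall>x\<in>S. \<forall>y\<in>S. idx x = idx y \<longrightarrow> d x y < e)"
proof -
  obtain q :: "nat \<Rightarrow> 'a" where q: "\<And>i. q i \<in> S" "\<And>x e. x \<in> S \<Longrightarrow> e > 0 \<Longrightarrow> \<exists>i. d (q i) x < e"
    using exists_dense_seq[OF assms(1)] by blast
  obtain idx :: "'a \<Rightarrow> nat" where idx: "idx \<in> \<B> \<rightarrow>\<^sub>M count_space UNIV" "\<forall>x\<in>S. d (q (idx x)) x < e / 2"
    using exists_countable_partition[OF _ q, of "e/2"] assms(2) by auto
  have "d x y < e" if "x \<in> S" "y \<in> S" "idx x = idx y" for x y
  proof -
    have "d x y \<le> d (q (idx x)) x + d (q (idx x)) y"
      using q(1) that by (intro triangle'') auto
    moreover have "d (q (idx x)) x < e / 2" "d (q (idx x)) y < e / 2"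
      using idx(2) that by auto
    ultimately show ?thesis by linarith
  qed
  then show ?thesis using idx(1) by blast
qed

end

section \<open>The Wasserstein metric\<close>

text \<open>A simple function below \<open>f\<close> pulls back along \<open>T\<close> to one below
  the composition. Because \<open>f\<close> may be non-measurable, symmetry of \<open>W1\<close>
  follows for any symmetric \<open>d\<close>.\<close>

lemma nn_integral_distr_le:
  assumes T: "T \<in> M \<rightarrow>\<^sub>M N"
  shows "(\<integral>\<^sup>+y. f y \<partial>distr M N T) \<le> (\<integral>\<^sup>+x. f (T x) \<partial>M)"
  unfolding nn_integral_def[of "distr M N T"]
proof (rule SUP_least, safe)
  fix g assume g: "simple_function (distr M N T) g" "g \<le> f"
  have "integral\<^sup>S (distr M N T) g = (\<integral>\<^sup>+y. g y \<partial>distr M N T)"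
    using g by (simp add: nn_integral_eq_simple_integral)
  also have "\<dots> = (\<integral>\<^sup>+x. g (T x) \<partial>M)"
    using g T borel_measurable_simple_function[OF g(1)] by (intro nn_integral_distr) auto
  also have "\<dots> \<le> (\<integral>\<^sup>+x. f (T x) \<partial>M)"
    using g(2) by (intro nn_integral_mono) (auto simp: le_fun_def)
  finally show "integral\<^sup>S (distr M N T) g \<le> (\<integral>\<^sup>+x. f (T x) \<partial>M)" .
qed

lemma swap_mem_couplings:
  assumes "\<pi> \<in> couplings \<mu> \<nu>"
  shows "distr \<pi> (\<nu> \<Otimes>\<^sub>M \<mu>) prod.swap \<in> couplings \<nu> \<mu>"
proof -
  have s: "sets \<pi> = sets (\<mu> \<Otimes>\<^sub>M \<nu>)" and p: "prob_space \<pi>"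
    and m: "distr \<pi> \<mu> fst = \<mu>" "distr \<pi> \<nu> snd = \<nu>"
    using assms by (auto simp: couplings_def)
  have sw: "prod.swap \<in> \<pi> \<rightarrow>\<^sub>M \<nu> \<Otimes>\<^sub>M \<mu>"
    unfolding measurable_cong_sets[OF s refl] prod.swap_def by measurable
  have "distr (distr \<pi> (\<nu> \<Otimes>\<^sub>M \<mu>) prod.swap) \<nu> fst = distr \<pi> \<nu> snd"
    using sw by (subst distr_distr) (auto simp: comp_def)
  moreover have "distr (distr \<pi> (\<nu> \<Otimes>\<^sub>M \<mu>) prod.swap) \<mu> snd = distr \<pi> \<mu> fst"
    using sw by (subst distr_distr) (auto simp: comp_def)
  ultimately show ?thesis
    using prob_space.prob_space_distr[OF p sw] m by (simp add: couplings_def)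
qed

lemma pair_measure_mem_couplings:
  assumes "prob_space \<mu>" "prob_space \<nu>"
  shows "\<mu> \<Otimes>\<^sub>M \<nu> \<in> couplings \<mu> \<nu>"
proof -
  interpret \<mu>: prob_space \<mu> by fact
  interpret \<nu>: prob_space \<nu> by fact
  interpret P: pair_prob_space \<mu> \<nu> ..
  have "distr (\<mu> \<Otimes>\<^sub>M \<nu>) \<nu> snd = \<nu>"
  proof (rule measure_eqI)
    fix A assume "A \<in> sets (distr (\<mu> \<Otimes>\<^sub>M \<nu>) \<nu> snd)"
    then have A: "A \<in> sets \<nu>" by simp
    then have "snd -` A \<inter> space (\<mu> \<Otimes>\<^sub>M \<nu>) = space \<mu> \<times> A"
      using sets.sets_into_space by (auto simp: space_pair_measure)
    then show "emeasure (distr (\<mu> \<Otimes>\<^sub>M \<nu>) \<nu> snd) A = emeasure \<nu> A"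
      using A by (simp add: emeasure_distr \<nu>.emeasure_pair_measure_Times \<mu>.emeasure_space_1)
  qed simp
  then show ?thesis
    using P.prob_space_axioms \<nu>.distr_pair_fst[of \<mu>]
    by (simp add: couplings_def)
qed

lemma W1_commute:
  assumes "\<And>x y. d x y = d y x"
  shows "W1 d \<mu> \<nu> = W1 d \<nu> \<mu>"
proof -
  have le: "(INF \<pi> \<in> couplings \<nu> \<mu>. \<integral>\<^sup>+ p. ennreal (d (fst p) (snd p)) \<partial>\<pi>)
      \<le> (INF \<pi> \<in> couplings \<mu> \<nu>. \<integral>\<^sup>+ p. ennreal (d (fst p) (snd p)) \<partial>\<pi>)" for \<mu> \<nu>
  proof (rule INF_greatest)
    fix \<pi> assume \<pi>: "\<pi> \<in> couplings \<mu> \<nu>"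
    then have s: "sets \<pi> = sets (\<mu> \<Otimes>\<^sub>M \<nu>)" by (simp add: couplings_def)
    have sw: "prod.swap \<in> \<pi> \<rightarrow>\<^sub>M \<nu> \<Otimes>\<^sub>M \<mu>"
      unfolding measurable_cong_sets[OF s refl] prod.swap_def by measurable
    have "(\<integral>\<^sup>+ p. ennreal (d (fst p) (snd p)) \<partial>distr \<pi> (\<nu> \<Otimes>\<^sub>M \<mu>) prod.swap)
        \<le> (\<integral>\<^sup>+ p. ennreal (d (fst (prod.swap p)) (snd (prod.swap p))) \<partial>\<pi>)"
      using sw by (rule nn_integral_distr_le)
    also have "\<dots> = (\<integral>\<^sup>+ p. ennreal (d (fst p) (snd p)) \<partial>\<pi>)"
      by (simp add: assms[of "snd _"])
    finally show "(INF \<pi> \<in> couplings \<nu> \<mu>. \<integral>\<^sup>+ p. ennreal (d (fst p) (snd p)) \<partial>\<pi>)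
        \<le> (\<integral>\<^sup>+ p. ennreal (d (fst p) (snd p)) \<partial>\<pi>)"
      using swap_mem_couplings[OF \<pi>] by (intro INF_lower2)
  qed
  show ?thesis unfolding W1_def using le[of \<mu> \<nu>] le[of \<nu> \<mu>] by (simp add: antisym)
qed

lemma W1_nonneg: "0 \<le> W1 d \<mu> \<nu>"
  by (simp add: W1_def)

context separable_Metric_space
begin

section \<open>Measures of finite first moment and near-optimal couplings\<close>

lemma P1_D:
  assumes "\<mu> \<in> P1 S d"
  shows "space \<mu> = S" "sets \<mu> = sets \<B>" "prob_space \<mu>"
  using assms by (auto simp: P1_def)

lemma couplings_iff:
  assumes "sets \<mu> = sets \<B>" "sets \<nu> = sets \<B>"
  shows "\<pi> \<in> couplings \<mu> \<nu> \<longleftrightarrow>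
    sets \<pi> = sets (\<B> \<Otimes>\<^sub>M \<B>) \<and> prob_space \<pi> \<and> distr \<pi> \<B> fst = \<mu> \<and> distr \<pi> \<B> snd = \<nu>"
proof -
  have "distr \<pi> \<mu> fst = distr \<pi> \<B> fst" "distr \<pi> \<nu> snd = distr \<pi> \<B> snd"
    using assms by (auto intro: distr_cong)
  moreover have "sets (\<mu> \<Otimes>\<^sub>M \<nu>) = sets (\<B> \<Otimes>\<^sub>M \<B>)"
    using assms by (rule sets_pair_measure_cong)
  ultimately show ?thesis by (simp add: couplings_def)
qed

text \<open>The joint law of \<open>f\<close> and \<open>g\<close> is a coupling. The triangle
  inequality, completeness and separability all estimate \<open>W1\<close> by realising both
  measures as laws of random points on one probability space.\<close>

lemma W1_distr_le:
  assumes L: "prob_space L" and [measurable]: "f \<in> L \<rightarrow>\<^sub>M \<B>" "g \<in> L \<rightarrow>\<^sub>M \<B>"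
    and le: "(\<integral>\<^sup>+\<omega>. ennreal (d (f \<omega>) (g \<omega>)) \<partial>L) \<le> ennreal r" "0 \<le> r"
  shows "W1 d (distr L \<B> f) (distr L \<B> g) \<le> r"
proof -
  let ?\<pi> = "distr L (\<B> \<Otimes>\<^sub>M \<B>) (\<lambda>\<omega>. (f \<omega>, g \<omega>))"
  have "?\<pi> \<in> couplings (distr L \<B> f) (distr L \<B> g)"
    by (auto simp: couplings_iff distr_distr comp_def intro!: prob_space.prob_space_distr L)
  then have "(INF \<pi> \<in> couplings (distr L \<B> f) (distr L \<B> g). \<integral>\<^sup>+ p. ennreal (d (fst p) (snd p)) \<partial>\<pi>)
      \<le> (\<integral>\<^sup>+ p. ennreal (d (fst p) (snd p)) \<partial>?\<pi>)"
    by (rule INF_lower)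
  also have "\<dots> = (\<integral>\<^sup>+\<omega>. ennreal (d (f \<omega>) (g \<omega>)) \<partial>L)"
    by (subst nn_integral_distr) auto
  also note le(1)
  finally show ?thesis
    unfolding W1_def using le(2) by (simp add: enn2real_leI)
qed

lemma distr_id_P1: "\<mu> \<in> P1 S d \<Longrightarrow> distr \<mu> \<B> (\<lambda>x. x) = \<mu>"
  by (rule distr_id2) (simp add: P1_D)

lemma P1_finite_moment:
  assumes "\<mu> \<in> P1 S d" "x \<in> S"
  shows "(\<integral>\<^sup>+y. ennreal (d x y) \<partial>\<mu>) < \<infinity>"
proof -
  interpret prob_space \<mu> using P1_D(3)[OF assms(1)] .
  obtain x0 where x0: "x0 \<in> S" "integrable \<mu> (\<lambda>y. d x0 y)"
    using assms(1) by (auto simp: P1_def)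
  have "(\<integral>\<^sup>+y. ennreal (d x y) \<partial>\<mu>) \<le> (\<integral>\<^sup>+y. ennreal (d x x0) + ennreal (d x0 y) \<partial>\<mu>)"
    using x0 assms P1_D(1)[OF assms(1)] triangle
    by (intro nn_integral_mono) (simp flip: ennreal_plus)
  also have "\<dots> = ennreal (d x x0) + (\<integral>\<^sup>+y. ennreal (d x0 y) \<partial>\<mu>)"
    using x0(2) by (subst nn_integral_add) (auto simp: emeasure_space_1)
  also have "\<dots> < \<infinity>"
    using x0(2) by (simp add: nn_integral_eq_integral)
  finally show ?thesis .
qed

lemma P1_I:
  assumes "prob_space \<mu>" "sets \<mu> = sets \<B>" "x \<in> S" "(\<integral>\<^sup>+y. ennreal (d x y) \<partial>\<mu>) < \<infinity>"
  shows "\<mu> \<in> P1 S d"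
proof -
  have "integrable \<mu> (\<lambda>y. d x y)"
    using dist_measurable1[OF assms(3)] assms(4)
    by (intro integrableI_nonneg) (auto simp: measurable_cong_sets[OF assms(2) refl])
  then show ?thesis
    using assms sets_eq_imp_space_eq[OF assms(2)] by (auto simp: P1_def)
qed

text \<open>A finite expected distance to a random point with finite first moment transfers the
  moment by the triangle inequality. It places both the limit law and the discretised measures in
  \<open>P1\<close>.\<close>

lemma P1_distr_near:
  assumes L: "prob_space L" and m[measurable]: "f \<in> L \<rightarrow>\<^sub>M \<B>" "g \<in> L \<rightarrow>\<^sub>M \<B>"
    and g: "distr L \<B> g \<in> P1 S d" and fin: "(\<integral>\<^sup>+\<omega>. ennreal (d (f \<omega>) (g \<omega>)) \<partial>L) < \<infinity>"
  shows "distr L \<B> f \<in> P1 S d"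
proof -
  interpret prob_space L by fact
  obtain x where x: "x \<in> S"
    using not_empty measurable_space[OF m(1)] by auto
  note [measurable] = dist_measurable1[OF x]
  have sp: "f \<omega> \<in> S" "g \<omega> \<in> S" if "\<omega> \<in> space L" for \<omega>
    using measurable_space[OF m(1) that] measurable_space[OF m(2) that] by auto
  have "(\<integral>\<^sup>+y. ennreal (d x y) \<partial>distr L \<B> f) = (\<integral>\<^sup>+\<omega>. ennreal (d x (f \<omega>)) \<partial>L)"
    by (subst nn_integral_distr) auto
  also have "\<dots> \<le> (\<integral>\<^sup>+\<omega>. ennreal (d x (g \<omega>)) + ennreal (d (f \<omega>) (g \<omega>)) \<partial>L)"
    using x sp triangle' by (intro nn_integral_mono) (simp flip: ennreal_plus)
  also have "\<dots> = (\<integral>\<^sup>+\<omega>. ennreal (d x (g \<omega>)) \<partial>L) + (\<integral>\<^sup>+\<omega>. ennreal (d (f \<omega>) (g \<omega>)) \<partial>L)"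
    by (rule nn_integral_add) measurable
  also have "(\<integral>\<^sup>+\<omega>. ennreal (d x (g \<omega>)) \<partial>L) = (\<integral>\<^sup>+y. ennreal (d x y) \<partial>distr L \<B> g)"
    by (subst nn_integral_distr) auto
  also have "\<dots> + (\<integral>\<^sup>+\<omega>. ennreal (d (f \<omega>) (g \<omega>)) \<partial>L) < \<infinity>"
    using P1_finite_moment[OF g x] fin by simp
  finally show ?thesis
    using x by (intro P1_I) (auto intro!: prob_space_distr)
qed

text \<open>Passing through a fixed point bounds the cost by the two first moments, which depend on
  the marginals alone.\<close>

lemma couplings_finite_cost:
  assumes "\<mu> \<in> P1 S d" "\<nu> \<in> P1 S d" and \<pi>: "\<pi> \<in> couplings \<mu> \<nu>"
  shows "(\<integral>\<^sup>+ p. ennreal (d (fst p) (snd p)) \<partial>\<pi>) < \<infinity>"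
proof -
  have s: "sets \<pi> = sets (\<B> \<Otimes>\<^sub>M \<B>)" and "prob_space \<pi>"
    and m: "distr \<pi> \<B> fst = \<mu>" "distr \<pi> \<B> snd = \<nu>"
    using \<pi> couplings_iff[OF P1_D(2) P1_D(2), OF assms(1,2)] by blast+
  interpret prob_space \<pi> by fact
  note ms = measurable_cong_sets[OF s refl]
  have sp: "fst p \<in> S" "snd p \<in> S" if "p \<in> space \<pi>" for p
    using that unfolding sets_eq_imp_space_eq[OF s] space_pair_measure by auto
  obtain x where x: "x \<in> S"
    using not_empty sp(1) by (meson ex_in_conv)
  note [measurable] = dist_measurable1[OF x]
  have "(\<integral>\<^sup>+ p. ennreal (d (fst p) (snd p)) \<partial>\<pi>) \<le>
      (\<integral>\<^sup>+ p. ennreal (d x (fst p)) + ennreal (d x (snd p)) \<partial>\<pi>)"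
    using x sp triangle'' by (intro nn_integral_mono) (simp flip: ennreal_plus)
  also have "\<dots> = (\<integral>\<^sup>+ p. ennreal (d x (fst p)) \<partial>\<pi>) + (\<integral>\<^sup>+ p. ennreal (d x (snd p)) \<partial>\<pi>)"
    by (rule nn_integral_add) (simp_all add: ms)
  also have "(\<integral>\<^sup>+ p. ennreal (d x (fst p)) \<partial>\<pi>) = (\<integral>\<^sup>+ y. ennreal (d x y) \<partial>\<mu>)"
    unfolding m(1)[symmetric] by (subst nn_integral_distr) (auto simp: ms)
  also have "(\<integral>\<^sup>+ p. ennreal (d x (snd p)) \<partial>\<pi>) = (\<integral>\<^sup>+ y. ennreal (d x y) \<partial>\<nu>)"
    unfolding m(2)[symmetric] by (subst nn_integral_distr) (auto simp: ms)
  also have "(\<integral>\<^sup>+ y. ennreal (d x y) \<partial>\<mu>) + (\<integral>\<^sup>+ y. ennreal (d x y) \<partial>\<nu>) < \<infinity>"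
    using P1_finite_moment[OF assms(1) x] P1_finite_moment[OF assms(2) x] by simp
  finally show ?thesis .
qed

text \<open>The product coupling has finite cost, so the infimum is finite and
  \<open>enn2real\<close> loses nothing; the definition of an infimum then supplies the
  coupling.\<close>

lemma exists_coupling_less:
  assumes "\<mu> \<in> P1 S d" "\<nu> \<in> P1 S d" "W1 d \<mu> \<nu> < r"
  obtains \<pi> where "sets \<pi> = sets (\<B> \<Otimes>\<^sub>M \<B>)" "prob_space \<pi>"
    "distr \<pi> \<B> fst = \<mu>" "distr \<pi> \<B> snd = \<nu>"
    "(\<integral>\<^sup>+ p. ennreal (d (fst p) (snd p)) \<partial>\<pi>) < ennreal r"
proof -
  let ?I = "INF \<pi> \<in> couplings \<mu> \<nu>. \<integral>\<^sup>+ p. ennreal (d (fst p) (snd p)) \<partial>\<pi>"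
  have c: "\<mu> \<Otimes>\<^sub>M \<nu> \<in> couplings \<mu> \<nu>"
    using assms by (intro pair_measure_mem_couplings P1_D(3))
  have "?I \<le> (\<integral>\<^sup>+ p. ennreal (d (fst p) (snd p)) \<partial>(\<mu> \<Otimes>\<^sub>M \<nu>))"
    by (rule INF_lower[OF c])
  also have "\<dots> < \<infinity>"
    by (rule couplings_finite_cost[OF assms(1,2) c])
  finally have "?I < \<infinity>" .
  then have "?I = ennreal (W1 d \<mu> \<nu>)"
    by (simp add: W1_def)
  also have "\<dots> < ennreal r"
    using assms(3) W1_nonneg[of d \<mu> \<nu>] by (simp add: ennreal_lessI)
  finally obtain \<pi> where "\<pi> \<in> couplings \<mu> \<nu>" "(\<integral>\<^sup>+ p. ennreal (d (fst p) (snd p)) \<partial>\<pi>) < ennreal r"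
    by (auto simp: INF_less_iff)
  then show ?thesis
    using that couplings_iff[OF P1_D(2) P1_D(2), OF assms(1,2)] by blast
qed

lemma W1_self:
  assumes "\<mu> \<in> P1 S d" shows "W1 d \<mu> \<mu> = 0"
proof -
  have m: "(\<lambda>x. x) \<in> \<mu> \<rightarrow>\<^sub>M \<B>"
    using P1_D(2)[OF assms] by (simp add: measurable_ident_sets)
  have "(\<integral>\<^sup>+x. ennreal (d x x) \<partial>\<mu>) = (\<integral>\<^sup>+x. 0 \<partial>\<mu>)"
    using P1_D(1)[OF assms] by (intro nn_integral_cong) auto
  then have "W1 d (distr \<mu> \<B> (\<lambda>x. x)) (distr \<mu> \<B> (\<lambda>x. x)) \<le> 0"
    by (intro W1_distr_le[OF P1_D(3)[OF assms] m m]) auto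
  then show ?thesis
    using W1_nonneg[of d \<mu> \<mu>] by (simp add: distr_id_P1[OF assms])
qed

text \<open>The cells have diameter less than \<open>e n\<close>; the second half of pair n and the
  first half of pair n+1 are indexed by the same \<open>idx n\<close>, so falling into the same cell
  puts them within \<open>e n\<close>.\<close>

lemma coupling_chain:
  assumes sets_\<pi>: "\<And>n. sets (\<pi> n) = sets (\<B> \<Otimes>\<^sub>M \<B>)" and prob: "\<And>n. prob_space (\<pi> n)"
    and match: "\<And>n. distr (\<pi> n) \<B> snd = distr (\<pi> (Suc n)) \<B> fst" and e: "\<And>n::nat. e n > 0"
  obtains L where "prob_space L" "sets L = sets (PiM UNIV (\<lambda>_::nat. \<B> \<Otimes>\<^sub>M \<B>))"
    "\<And>n. distr L (\<B> \<Otimes>\<^sub>M \<B>) (\<lambda>\<omega>. \<omega> n) = \<pi> n"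
    "\<And>n. AE \<omega> in L. d (snd (\<omega> n)) (fst (\<omega> (Suc n))) < e n"
proof -
  have ne: "S \<noteq> {}"
  proof -
    obtain p where "p \<in> space (\<pi> 0)"
      using prob_space.not_empty[OF prob[of 0]] by auto
    then show ?thesis
      using sets_eq_imp_space_eq[OF sets_\<pi>[of 0]] by (auto simp: space_pair_measure)
  qed
  have "\<exists>idx::'a \<Rightarrow> nat. idx \<in> \<B> \<rightarrow>\<^sub>M count_space UNIV \<and>
           (\<forall>x\<in>S. \<forall>y\<in>S. idx x = idx y \<longrightarrow> d x y < e n)" for n
    by (rule exists_index[OF ne e])
  then obtain idx :: "nat \<Rightarrow> 'a \<Rightarrow> nat" where idx[measurable]: "\<And>n. idx n \<in> \<B> \<rightarrow>\<^sub>M count_space UNIV"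
    and close: "\<And>n x y. x \<in> S \<Longrightarrow> y \<in> S \<Longrightarrow> idx n x = idx n y \<Longrightarrow> d x y < e n"
    by metis
  have mf: "fst \<in> \<pi> n \<rightarrow>\<^sub>M \<B>" "snd \<in> \<pi> n \<rightarrow>\<^sub>M \<B>" for n
    by (simp_all add: measurable_cong_sets[OF sets_\<pi> refl])
  have "distr (\<pi> n) (count_space UNIV) (\<lambda>p. idx n (snd p)) =
      distr (\<pi> (Suc n)) (count_space UNIV) (\<lambda>p. idx n (fst p))" for n
  proof -
    have "distr (\<pi> n) (count_space UNIV) (\<lambda>p. idx n (snd p)) = distr (distr (\<pi> n) \<B> snd) (count_space UNIV) (idx n)"
      using mf by (subst distr_distr) (auto simp: comp_def)
    also have "\<dots> = distr (\<pi> (Suc n)) (count_space UNIV) (\<lambda>p. idx n (fst p))"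
      unfolding match using mf by (subst distr_distr) (auto simp: comp_def)
    finally show ?thesis .
  qed
  then obtain L where L: "prob_space L" "sets L = sets (PiM UNIV (\<lambda>_. \<B> \<Otimes>\<^sub>M \<B>))"
    "\<And>n. distr L (\<B> \<Otimes>\<^sub>M \<B>) (\<lambda>\<omega>. \<omega> n) = \<pi> n"
    "\<And>n. AE \<omega> in L. idx n (snd (\<omega> n)) = idx n (fst (\<omega> (Suc n)))"
    using exists_nat_matched_chain[of \<pi> "\<B> \<Otimes>\<^sub>M \<B>" "\<lambda>n p. idx n (snd p)" "\<lambda>n p. idx n (fst p)",
      OF sets_\<pi> prob] by auto
  have "AE \<omega> in L. d (snd (\<omega> n)) (fst (\<omega> (Suc n))) < e n" for n
    using L(4)[of n] AE_space
  proof eventually_elim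
    case (elim \<omega>)
    have "\<omega> k \<in> S \<times> S" for k
      using elim(2) unfolding sets_eq_imp_space_eq[OF L(2)] space_PiM space_pair_measure by auto
    then have "snd (\<omega> n) \<in> S" "fst (\<omega> (Suc n)) \<in> S"
      by (auto simp: mem_Times_iff)
    with elim(1) show ?case by (intro close)
  qed
  with L(1-3) that show ?thesis by blast
qed

text \<open>Under a coupling of small cost, a point of \<open>F\<close> is moved by less than e =
  1/(k+1), hence stays in the neighbourhood \<open>V k\<close>, except on an event that Markov's
  inequality controls. The neighbourhoods decrease to \<open>F\<close> because \<open>F\<close> is
  closed.\<close>

lemma W1_zero_imp_le_closed:
  assumes \<mu>: "\<mu> \<in> P1 S d" and \<nu>: "\<nu> \<in> P1 S d" and zero: "W1 d \<mu> \<nu> = 0"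
    and F: "closedin mtopology F"
  shows "measure \<mu> F \<le> measure \<nu> F"
proof -
  interpret \<nu>: prob_space \<nu> using P1_D(3)[OF \<nu>] .
  have FS: "F \<subseteq> S" using closedin_subset[OF F] by simp
  define V where "V k = (\<Union>x\<in>F. mball x (1 / Suc k))" for k :: nat
  have Vo: "openin mtopology (V k)" for k
    unfolding V_def by (auto intro: openin_Union)
  have mV[measurable]: "V k \<in> sets \<B>" for k
    by (rule borel_of_open[OF Vo])
  have mF[measurable]: "F \<in> sets \<B>" by (rule borel_of_closed[OF F])
  have dec: "decseq V"
  proof (rule decseq_SucI)
    fix n show "V (Suc n) \<subseteq> V n"
      unfolding V_def by (intro UN_mono mball_subset_concentric) (auto simp: field_simps)
  qed
  have Int: "(\<Inter>k. V k) = F"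
  proof (intro equalityI subsetI)
    fix x assume "x \<in> (\<Inter>k. V k)"
    then have x: "\<exists>y\<in>F. x \<in> mball y (1 / Suc k)" for k by (auto simp: V_def)
    then have xS: "x \<in> S" by auto
    have "\<exists>y\<in>F. y \<in> mball x r" if r: "r > 0" for r
    proof -
      obtain k where k: "1 / Suc k < r" using nat_approx_posE[OF r] by auto
      obtain y where "y \<in> F" "x \<in> mball y (1 / Suc k)" using x by blast
      then show ?thesis using k by (intro bexI[of _ y]) (auto simp: commute)
    qed
    then have "x \<in> mtopology closure_of F"
      using xS unfolding metric_closure_of by blast
    then show "x \<in> F" using F by (simp add: closure_of_closedin)
  next
    fix x assume "x \<in> F"
    then show "x \<in> (\<Inter>k. V k)" using FS by (auto simp: V_def intro!: bexI[of _ x])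
  qed
  have "measure \<mu> F \<le> measure \<nu> (V k) + 1 / Suc k" for k
  proof -
    define e where "e = 1 / Suc k"
    have e: "e > 0" by (simp add: e_def)
    \<comment> \<open>A cost below e * e leaves exceptional probability at most e after division by
      the threshold e.\<close>
    obtain \<pi> where \<pi>: "sets \<pi> = sets (\<B> \<Otimes>\<^sub>M \<B>)" "prob_space \<pi>"
      "distr \<pi> \<B> fst = \<mu>" "distr \<pi> \<B> snd = \<nu>"
      "(\<integral>\<^sup>+ p. ennreal (d (fst p) (snd p)) \<partial>\<pi>) < ennreal (e * e)"
      using exists_coupling_less[OF \<mu> \<nu>, of "e * e"] zero e by auto
    interpret \<pi>: prob_space \<pi> by fact
    note ms = measurable_cong_sets[OF \<pi>(1) refl]
    have sp: "space \<pi> = S \<times> S"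
      unfolding sets_eq_imp_space_eq[OF \<pi>(1)] space_pair_measure by simp
    have [measurable]: "fst \<in> \<pi> \<rightarrow>\<^sub>M \<B>" "snd \<in> \<pi> \<rightarrow>\<^sub>M \<B>" by (simp_all add: ms)
    let ?D = "{p \<in> space \<pi>. e \<le> d (fst p) (snd p)}"
    have "emeasure \<pi> {p \<in> space \<pi>. 1 \<le> ennreal (1/e) * ennreal (d (fst p) (snd p))}
        \<le> ennreal (1/e) * (\<integral>\<^sup>+ p. ennreal (d (fst p) (snd p)) * indicator (space \<pi>) p \<partial>\<pi>)"
      using nn_integral_Markov_inequality[of "\<lambda>p. ennreal (d (fst p) (snd p))" "space \<pi>" \<pi> "ennreal (1/e)"]
      by simp
    also have "(\<integral>\<^sup>+ p. ennreal (d (fst p) (snd p)) * indicator (space \<pi>) p \<partial>\<pi>) =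
        (\<integral>\<^sup>+ p. ennreal (d (fst p) (snd p)) \<partial>\<pi>)"
      by (intro nn_integral_cong) simp
    also have "ennreal (1/e) * \<dots> \<le> ennreal (1/e) * ennreal (e * e)"
      using \<pi>(5) by (intro mult_left_mono) auto
    also have "\<dots> = ennreal e"
      using e by (simp flip: ennreal_mult)
    also have "{p \<in> space \<pi>. 1 \<le> ennreal (1/e) * ennreal (d (fst p) (snd p))} = ?D"
      using e by (auto simp: field_simps simp flip: ennreal_mult)
    finally have D: "measure \<pi> ?D \<le> e"
      using e by (simp add: \<pi>.emeasure_eq_measure)
    have "measure \<mu> F = measure \<pi> (fst -` F \<inter> space \<pi>)"
      unfolding \<pi>(3)[symmetric] by (rule measure_distr) measurable
    also have "\<dots> \<le> measure \<pi> ((snd -` V k \<inter> space \<pi>) \<union> ?D)"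
    proof (rule \<pi>.finite_measure_mono)
      show "fst -` F \<inter> space \<pi> \<subseteq> (snd -` V k \<inter> space \<pi>) \<union> ?D"
        unfolding V_def e_def by (force simp: sp)
    qed measurable
    also have "\<dots> \<le> measure \<pi> (snd -` V k \<inter> space \<pi>) + measure \<pi> ?D"
      by (rule measure_Un_le) measurable
    also have "measure \<pi> (snd -` V k \<inter> space \<pi>) = measure \<nu> (V k)"
      unfolding \<pi>(4)[symmetric] by (rule measure_distr[symmetric]) measurable
    finally show ?thesis using D by (simp add: e_def)
  qed
  moreover have "(\<lambda>k. measure \<nu> (V k) + 1 / Suc k) \<longlonglongrightarrow> measure \<nu> F + 0"
  proof (rule tendsto_add)
    have "range V \<subseteq> sets \<nu>"
      unfolding P1_D(2)[OF \<nu>] using mV by blast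
    from \<nu>.finite_Lim_measure_decseq[OF this dec]
    show "(\<lambda>k. measure \<nu> (V k)) \<longlonglongrightarrow> measure \<nu> F"
      by (simp add: Int)
    show "(\<lambda>k. 1 / Suc k) \<longlonglongrightarrow> 0"
      using LIMSEQ_inverse_real_of_nat by (simp add: inverse_eq_divide)
  qed
  ultimately show ?thesis
    by (intro LIMSEQ_le_const[of _ "measure \<nu> F"]) auto
qed

text \<open>The inequality on closed sets, used in both directions, gives equality on closed and
  hence on open sets, which form an intersection-stable generator.\<close>

lemma W1_zero_imp_eq:
  assumes \<mu>: "\<mu> \<in> P1 S d" and \<nu>: "\<nu> \<in> P1 S d" and zero: "W1 d \<mu> \<nu> = 0"
  shows "\<mu> = \<nu>"
proof -
  interpret \<mu>: prob_space \<mu> using P1_D(3)[OF \<mu>] .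
  interpret \<nu>: prob_space \<nu> using P1_D(3)[OF \<nu>] .
  have zero': "W1 d \<nu> \<mu> = 0" using zero W1_commute[of d] commute by metis
  have eq: "emeasure \<mu> U = emeasure \<nu> U" if U: "openin mtopology U" for U
  proof -
    have F: "closedin mtopology (S - U)"
      using closedin_diff[OF closedin_mspace U] .
    have "measure \<mu> (S - U) = measure \<nu> (S - U)"
      using W1_zero_imp_le_closed[OF \<mu> \<nu> zero F] W1_zero_imp_le_closed[OF \<nu> \<mu> zero' F] by simp
    moreover have "U \<in> sets \<mu>" "U \<in> sets \<nu>"
      using borel_of_open[OF U] P1_D(2) \<mu> \<nu> by auto
    ultimately have "measure \<mu> U = measure \<nu> U"
      using \<mu>.prob_compl[of U] \<nu>.prob_compl[of U] P1_D(1)[OF \<mu>] P1_D(1)[OF \<nu>] by simp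
    then show ?thesis by (simp add: \<mu>.emeasure_eq_measure \<nu>.emeasure_eq_measure)
  qed
  show ?thesis
  proof (rule measure_eqI_generator_eq[where E = "{U. openin mtopology U}" and \<Omega> = S and A = "\<lambda>_. S"])
    show "Int_stable {U. openin mtopology U}" by (auto simp: Int_stable_def)
    show "{U. openin mtopology U} \<subseteq> Pow S" by (auto dest!: openin_subset)
    show "sets \<mu> = sigma_sets S {U. openin mtopology U}" "sets \<nu> = sigma_sets S {U. openin mtopology U}"
      using P1_D(2)[OF \<mu>] P1_D(2)[OF \<nu>] by (simp_all add: sets_borel_of)
    show "range (\<lambda>_. S) \<subseteq> {U. openin mtopology U}" "(\<Union>i::nat. S) = S" by auto
  qed (auto simp: eq)
qed

lemma W1_triangle:
  assumes \<mu>: "\<mu> \<in> P1 S d" and \<nu>: "\<nu> \<in> P1 S d" and \<rho>: "\<rho> \<in> P1 S d"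
  shows "W1 d \<mu> \<rho> \<le> W1 d \<mu> \<nu> + W1 d \<nu> \<rho>"
proof (rule field_le_epsilon)
  fix e0 :: real assume "e0 > 0"
  \<comment> \<open>Three errors of size e occur: each of the two couplings is optimal up to e, and
    the gluing costs e.\<close>
  define e where "e = e0 / 3"
  have e: "e > 0" using \<open>e0 > 0\<close> by (simp add: e_def)
  obtain \<pi>1 where \<pi>1: "sets \<pi>1 = sets (\<B> \<Otimes>\<^sub>M \<B>)" "prob_space \<pi>1"
      "distr \<pi>1 \<B> fst = \<mu>" "distr \<pi>1 \<B> snd = \<nu>"
      "(\<integral>\<^sup>+ p. ennreal (d (fst p) (snd p)) \<partial>\<pi>1) < ennreal (W1 d \<mu> \<nu> + e)"
    using exists_coupling_less[OF \<mu> \<nu>, of "W1 d \<mu> \<nu> + e"] e by auto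
  obtain \<pi>2 where \<pi>2: "sets \<pi>2 = sets (\<B> \<Otimes>\<^sub>M \<B>)" "prob_space \<pi>2"
      "distr \<pi>2 \<B> fst = \<nu>" "distr \<pi>2 \<B> snd = \<rho>"
      "(\<integral>\<^sup>+ p. ennreal (d (fst p) (snd p)) \<partial>\<pi>2) < ennreal (W1 d \<nu> \<rho> + e)"
    using exists_coupling_less[OF \<nu> \<rho>, of "W1 d \<nu> \<rho> + e"] e by auto
  have c: "\<rho> \<Otimes>\<^sub>M \<rho> \<in> couplings \<rho> \<rho>"
    using pair_measure_mem_couplings P1_D(3)[OF \<rho>] by blast
  have \<pi>3: "sets (\<rho> \<Otimes>\<^sub>M \<rho>) = sets (\<B> \<Otimes>\<^sub>M \<B>)" "prob_space (\<rho> \<Otimes>\<^sub>M \<rho>)"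
      "distr (\<rho> \<Otimes>\<^sub>M \<rho>) \<B> fst = \<rho>" "distr (\<rho> \<Otimes>\<^sub>M \<rho>) \<B> snd = \<rho>"
    using c couplings_iff[OF P1_D(2) P1_D(2), OF \<rho> \<rho>] by blast+
  \<comment> \<open>The chain must be infinite. From index 2 on it is padded by the product coupling
    of \<rho> with itself, which keeps all marginals matched; only coordinates 0 and 1 are
    read.\<close>
  define \<pi> where "\<pi> n = (case n of 0 \<Rightarrow> \<pi>1 | Suc 0 \<Rightarrow> \<pi>2 | Suc (Suc n) \<Rightarrow> \<rho> \<Otimes>\<^sub>M \<rho>)" for n :: nat
  obtain L where L: "prob_space L" "sets L = sets (PiM UNIV (\<lambda>_::nat. \<B> \<Otimes>\<^sub>M \<B>))"
    "\<And>n. distr L (\<B> \<Otimes>\<^sub>M \<B>) (\<lambda>\<omega>. \<omega> n) = \<pi> n"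
    "\<And>n. AE \<omega> in L. d (snd (\<omega> n)) (fst (\<omega> (Suc n))) < e"
  proof (rule coupling_chain[of \<pi> "\<lambda>_. e"])
    show "sets (\<pi> n) = sets (\<B> \<Otimes>\<^sub>M \<B>)" "prob_space (\<pi> n)"
      "distr (\<pi> n) \<B> snd = distr (\<pi> (Suc n)) \<B> fst" for n
      using \<pi>1 \<pi>2 \<pi>3 by (auto simp: \<pi>_def split: nat.split)
  qed (use e in auto)
  interpret L: prob_space L by fact
  have ev[measurable]: "(\<lambda>\<omega>. \<omega> n) \<in> L \<rightarrow>\<^sub>M \<B> \<Otimes>\<^sub>M \<B>" for n
    by (simp add: measurable_cong_sets[OF L(2) refl])
  have sp: "fst (\<omega> n) \<in> S" "snd (\<omega> n) \<in> S" if "\<omega> \<in> space L" for \<omega> n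
    using measurable_space[OF ev[of n] that] unfolding space_pair_measure by auto
  have cost: "(\<integral>\<^sup>+\<omega>. ennreal (d (fst (\<omega> n)) (snd (\<omega> n))) \<partial>L) = (\<integral>\<^sup>+ p. ennreal (d (fst p) (snd p)) \<partial>\<pi> n)" for n
    unfolding L(3)[symmetric] by (subst nn_integral_distr) auto
  have "W1 d (distr L \<B> (\<lambda>\<omega>. fst (\<omega> 0))) (distr L \<B> (\<lambda>\<omega>. snd (\<omega> 1))) \<le> W1 d \<mu> \<nu> + e + (e + (W1 d \<nu> \<rho> + e))"
  proof (rule W1_distr_le[OF L(1)])
    have "(\<integral>\<^sup>+\<omega>. ennreal (d (fst (\<omega> 0)) (snd (\<omega> 1))) \<partial>L) \<le>
        (\<integral>\<^sup>+\<omega>. ennreal (d (fst (\<omega> 0)) (snd (\<omega> 0))) + (ennreal e + ennreal (d (fst (\<omega> 1)) (snd (\<omega> 1)))) \<partial>L)"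
    proof (rule nn_integral_mono_AE)
      show "AE \<omega> in L. ennreal (d (fst (\<omega> 0)) (snd (\<omega> 1))) \<le>
          ennreal (d (fst (\<omega> 0)) (snd (\<omega> 0))) + (ennreal e + ennreal (d (fst (\<omega> 1)) (snd (\<omega> 1))))"
        using L(4)[of 0] AE_space
      proof eventually_elim
        case (elim \<omega>)
        have "d (fst (\<omega> 0)) (snd (\<omega> 1)) \<le> d (fst (\<omega> 0)) (snd (\<omega> 0)) + d (snd (\<omega> 0)) (snd (\<omega> 1))"
          "d (snd (\<omega> 0)) (snd (\<omega> 1)) \<le> d (snd (\<omega> 0)) (fst (\<omega> 1)) + d (fst (\<omega> 1)) (snd (\<omega> 1))"
          using sp[OF elim(2)] by (auto intro!: triangle)
        then have "d (fst (\<omega> 0)) (snd (\<omega> 1)) \<le> d (fst (\<omega> 0)) (snd (\<omega> 0)) + (e + d (fst (\<omega> 1)) (snd (\<omega> 1)))"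
          using elim(1) by simp
        then show ?case using e by (simp flip: ennreal_plus)
      qed
    qed
    also have "\<dots> = (\<integral>\<^sup>+\<omega>. ennreal (d (fst (\<omega> 0)) (snd (\<omega> 0))) \<partial>L) +
        (ennreal e + (\<integral>\<^sup>+\<omega>. ennreal (d (fst (\<omega> 1)) (snd (\<omega> 1))) \<partial>L))"
      by (simp add: nn_integral_add L.emeasure_space_1)
    also have "\<dots> \<le> ennreal (W1 d \<mu> \<nu> + e) + (ennreal e + ennreal (W1 d \<nu> \<rho> + e))"
      unfolding cost using \<pi>1(5) \<pi>2(5) by (intro add_mono) (auto simp: \<pi>_def)
    also have "\<dots> = ennreal (W1 d \<mu> \<nu> + e + (e + (W1 d \<nu> \<rho> + e)))"
      using e W1_nonneg[of d] by (simp flip: ennreal_plus)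
    finally show "(\<integral>\<^sup>+\<omega>. ennreal (d (fst (\<omega> 0)) (snd (\<omega> 1))) \<partial>L) \<le> ennreal (W1 d \<mu> \<nu> + e + (e + (W1 d \<nu> \<rho> + e)))" .
    show "0 \<le> W1 d \<mu> \<nu> + e + (e + (W1 d \<nu> \<rho> + e))"
      using e W1_nonneg[of d \<mu> \<nu>] W1_nonneg[of d \<nu> \<rho>] by simp
  qed measurable
  also have "distr L \<B> (\<lambda>\<omega>. fst (\<omega> 0)) = distr (\<pi> 0) \<B> fst"
    unfolding L(3)[symmetric] by (subst distr_distr) (auto simp: comp_def)
  also have "distr L \<B> (\<lambda>\<omega>. snd (\<omega> 1)) = distr (\<pi> 1) \<B> snd"
    unfolding L(3)[symmetric] by (subst distr_distr) (auto simp: comp_def)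
  finally show "W1 d \<mu> \<rho> \<le> W1 d \<mu> \<nu> + W1 d \<nu> \<rho> + e0"
    using \<pi>1 \<pi>2 by (simp add: \<pi>_def e_def)
qed

lemma Metric_space_P1: "Metric_space (P1 S d) (W1 d)"
proof
  show "0 \<le> W1 d x y" for x y by (rule W1_nonneg)
  show "W1 d x y = W1 d y x" for x y by (rule W1_commute[OF commute])
  show "W1 d x y = 0 \<longleftrightarrow> x = y" if "x \<in> P1 S d" "y \<in> P1 S d" for x y
    using W1_zero_imp_eq[OF that] W1_self[OF that(1)] by auto
  show "W1 d x z \<le> W1 d x y + W1 d y z" if "x \<in> P1 S d" "y \<in> P1 S d" "z \<in> P1 S d" for x y z
    by (rule W1_triangle[OF that])
qed

end

section \<open>Completeness\<close>

text \<open>The length of the path bounds all its displacements. The explicit tail bound is kept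
  because it is integrated over the paths later.\<close>

lemma (in Metric_space) summable_dist_limit:
  assumes complete: "mcomplete" and x: "\<And>n. x n \<in> M" and sm: "summable (\<lambda>n. d (x n) (x (Suc n)))"
  shows "\<exists>y\<in>M. (\<lambda>n. d (x n) y) \<longlonglongrightarrow> 0 \<and>
           (\<forall>n. d (x n) y \<le> (\<Sum>k. d (x (k + n)) (x (Suc (k + n)))))"
proof -
  define D where "D n = d (x n) (x (Suc n))" for n
  define R where "R n = (\<Sum>k. D (k + n))" for n
  have smD: "summable D" using sm by (simp add: D_def[abs_def])
  have "d (x n) (x (n + m)) \<le> (\<Sum>k<m. D (k + n))" for n m
  proof (induction m)
    case 0
    then show ?case using x by simp
  next
    case (Suc m)
    have "d (x n) (x (n + Suc m)) \<le> d (x n) (x (n + m)) + d (x (n + m)) (x (n + Suc m))"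
      by (intro triangle x)
    then show ?case using Suc by (simp add: D_def add.commute)
  qed
  moreover have "(\<Sum>k<m. D (k + n)) \<le> R n" for n m
    unfolding R_def by (intro sum_le_suminf summable_ignore_initial_segment smD) (auto simp: D_def)
  ultimately have fin: "d (x n) (x (n + m)) \<le> R n" for n m
    by (rule order_trans)
  have R0: "R \<longlonglongrightarrow> 0"
  proof -
    have "(\<lambda>n. suminf D - (\<Sum>i<n. D i)) \<longlonglongrightarrow> suminf D - suminf D"
      by (intro tendsto_diff tendsto_const summable_LIMSEQ smD)
    then show ?thesis
      by (simp add: R_def[abs_def] suminf_minus_initial_segment[OF smD])
  qed
  have "MCauchy x"
    unfolding MCauchy_def
  proof (intro conjI allI impI)
    show "range x \<subseteq> M" using x by auto
    fix e :: real assume "e > 0"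
    then obtain N where "\<bar>R N\<bar> < e / 2"
      using LIMSEQ_D[OF R0, of "e/2"] by auto
    then have N: "R N < e / 2" by simp
    have "d (x n) (x n') < e" if "N \<le> n" "N \<le> n'" for n n'
    proof -
      have "d (x n) (x n') \<le> d (x N) (x n) + d (x N) (x n')"
        by (intro triangle'' x)
      also have "\<dots> \<le> R N + R N"
        using fin[of N "n - N"] fin[of N "n' - N"] that by (intro add_mono) auto
      finally show ?thesis using N by simp
    qed
    then show "\<exists>N. \<forall>n n'. N \<le> n \<longrightarrow> N \<le> n' \<longrightarrow> d (x n) (x n') < e" by blast
  qed
  then obtain y where "limitin mtopology x y sequentially"
    using complete by (auto simp: mcomplete_def)
  then have y: "y \<in> M" "(\<lambda>n. d (x n) y) \<longlonglongrightarrow> 0"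
    by (auto simp: limitin_metric_dist_null)
  have "d (x n) y \<le> R n" for n
  proof (rule LIMSEQ_le_const)
    have "(\<lambda>m. R n + d (x (m + n)) y) \<longlonglongrightarrow> R n + 0"
      by (intro tendsto_add tendsto_const LIMSEQ_ignore_initial_segment y)
    then show "(\<lambda>m. R n + d (x (m + n)) y) \<longlonglongrightarrow> R n" by simp
    have "d (x n) y \<le> R n + d (x (m + n)) y" for m
      using triangle[OF x x y(1), of n "n + m"] fin[of n m] by (simp add: add.commute)
    then show "\<exists>N. \<forall>m\<ge>N. d (x n) y \<le> R n + d (x (m + n)) y" by blast
  qed
  with y show ?thesis by (auto simp: R_def D_def)
qed

context separable_Metric_space
begin

text \<open>One step of the process costs (1/2)^n for transport and (1/2)^n for gluing, so the
  expected tail from n is at most the sum of 2 * (1/2)^(k+n), which is 4 * (1/2)^n. This bounds the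
  expected distance between the n-th random point and the pathwise limit.\<close>

lemma P1_convergent_of_summable:
  assumes complete: "mcomplete" and \<sigma>: "\<And>k. \<sigma> k \<in> P1 S d"
    and close: "\<And>k. W1 d (\<sigma> k) (\<sigma> (Suc k)) < (1/2)^k"
  shows "\<exists>\<mu>\<in>P1 S d. \<forall>n. W1 d (\<sigma> n) \<mu> \<le> 4 * (1/2)^n"
proof -
  define \<pi>P where "\<pi>P k \<pi> \<longleftrightarrow> sets \<pi> = sets (\<B> \<Otimes>\<^sub>M \<B>) \<and> prob_space \<pi> \<and>
      distr \<pi> \<B> fst = \<sigma> k \<and> distr \<pi> \<B> snd = \<sigma> (Suc k) \<and>
      (\<integral>\<^sup>+ p. ennreal (d (fst p) (snd p)) \<partial>\<pi>) < ennreal ((1/2)^k)" for k \<pi>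
  have "\<exists>\<pi>. \<pi>P k \<pi>" for k
    by (rule exists_coupling_less[OF \<sigma> \<sigma> close, of k]) (unfold \<pi>P_def, blast)
  then obtain \<pi> where \<pi>P: "\<And>k. \<pi>P k (\<pi> k)" by metis
  then have \<pi>: "\<And>k. sets (\<pi> k) = sets (\<B> \<Otimes>\<^sub>M \<B>)" "\<And>k. prob_space (\<pi> k)"
    "\<And>k. distr (\<pi> k) \<B> fst = \<sigma> k" "\<And>k. distr (\<pi> k) \<B> snd = \<sigma> (Suc k)"
    "\<And>k. (\<integral>\<^sup>+ p. ennreal (d (fst p) (snd p)) \<partial>\<pi> k) < ennreal ((1/2)^k)"
    by (simp_all add: \<pi>P_def)
  obtain L where L: "prob_space L" "sets L = sets (PiM UNIV (\<lambda>_::nat. \<B> \<Otimes>\<^sub>M \<B>))"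
    "\<And>n. distr L (\<B> \<Otimes>\<^sub>M \<B>) (\<lambda>\<omega>. \<omega> n) = \<pi> n"
    "\<And>n. AE \<omega> in L. d (snd (\<omega> n)) (fst (\<omega> (Suc n))) < (1/2)^n"
    using coupling_chain[of \<pi> "\<lambda>n. (1/2)^n"] \<pi> by auto
  interpret L: prob_space L by fact
  have ev[measurable]: "(\<lambda>\<omega>. \<omega> n) \<in> L \<rightarrow>\<^sub>M \<B> \<Otimes>\<^sub>M \<B>" for n
    by (simp add: measurable_cong_sets[OF L(2) refl])
  have sp: "fst (\<omega> n) \<in> S" "snd (\<omega> n) \<in> S" if "\<omega> \<in> space L" for \<omega> n
    using measurable_space[OF ev[of n] that] unfolding space_pair_measure by auto
  define X where "X n \<omega> = fst (\<omega> n)" for n and \<omega> :: "nat \<Rightarrow> 'a \<times> 'a"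
  have X[measurable]: "X n \<in> L \<rightarrow>\<^sub>M \<B>" for n
    unfolding X_def by measurable
  have XS: "X n \<omega> \<in> S" if "\<omega> \<in> space L" for n \<omega>
    using sp[OF that] by (simp add: X_def)
  have lawX: "distr L \<B> (X n) = \<sigma> n" for n
  proof -
    have "distr L \<B> (X n) = distr (\<pi> n) \<B> fst"
      unfolding L(3)[symmetric] by (subst distr_distr) (auto simp: comp_def X_def[abs_def])
    then show ?thesis by (simp add: \<pi>)
  qed
  define D where "D n \<omega> = d (X n \<omega>) (X (Suc n) \<omega>)" for n \<omega>
  have [measurable]: "D n \<in> borel_measurable L" for n
    unfolding D_def by measurable
  have intD: "(\<integral>\<^sup>+\<omega>. ennreal (D n \<omega>) \<partial>L) \<le> ennreal (2 * (1/2)^n)" for n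
  proof -
    have "(\<integral>\<^sup>+\<omega>. ennreal (D n \<omega>) \<partial>L) \<le>
        (\<integral>\<^sup>+\<omega>. ennreal (d (fst (\<omega> n)) (snd (\<omega> n))) + ennreal ((1/2)^n) \<partial>L)"
    proof (rule nn_integral_mono_AE)
      show "AE \<omega> in L. ennreal (D n \<omega>) \<le> ennreal (d (fst (\<omega> n)) (snd (\<omega> n))) + ennreal ((1/2)^n)"
        using L(4)[of n] AE_space
      proof eventually_elim
        case (elim \<omega>)
        have "D n \<omega> \<le> d (fst (\<omega> n)) (snd (\<omega> n)) + d (snd (\<omega> n)) (fst (\<omega> (Suc n)))"
          unfolding D_def X_def using sp[OF elim(2)] by (intro triangle)
        then have "D n \<omega> \<le> d (fst (\<omega> n)) (snd (\<omega> n)) + (1/2)^n" using elim(1) by simp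
        then show ?case by (simp flip: ennreal_plus)
      qed
    qed
    also have "\<dots> = (\<integral>\<^sup>+\<omega>. ennreal (d (fst (\<omega> n)) (snd (\<omega> n))) \<partial>L) + ennreal ((1/2)^n)"
      by (simp add: nn_integral_add L.emeasure_space_1)
    also have "(\<integral>\<^sup>+\<omega>. ennreal (d (fst (\<omega> n)) (snd (\<omega> n))) \<partial>L) = (\<integral>\<^sup>+ p. ennreal (d (fst p) (snd p)) \<partial>\<pi> n)"
      unfolding L(3)[symmetric] by (subst nn_integral_distr) auto
    also have "\<dots> + ennreal ((1/2)^n) \<le> ennreal ((1/2)^n) + ennreal ((1/2)^n)"
      using \<pi>(5)[of n] by (intro add_mono) auto
    also have "\<dots> = ennreal (2 * (1/2)^n)"
      by (simp flip: ennreal_plus)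
    finally show ?thesis .
  qed
  have tail: "(\<integral>\<^sup>+\<omega>. (\<Sum>k. ennreal (D (k + n) \<omega>)) \<partial>L) \<le> ennreal (4 * (1/2)^n)" for n
  proof -
    have "(\<integral>\<^sup>+\<omega>. (\<Sum>k. ennreal (D (k + n) \<omega>)) \<partial>L) = (\<Sum>k. \<integral>\<^sup>+\<omega>. ennreal (D (k + n) \<omega>) \<partial>L)"
      by (rule nn_integral_suminf) measurable
    also have "\<dots> \<le> (\<Sum>k. ennreal (2 * (1/2)^(k + n)))"
      by (intro suminf_le intD) auto
    also have "\<dots> = ennreal (4 * (1/2)^n)"
    proof (rule suminf_ennreal_eq)
      have "(\<lambda>k. (2 * (1/2)^n) * (1/2)^k) sums ((2 * (1/2)^n) * (1 / (1 - 1/2 :: real)))"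
        by (intro sums_mult geometric_sums) simp
      then show "(\<lambda>k. 2 * (1/2)^(k + n)) sums (4 * (1/2 :: real)^n)"
        by (simp add: power_add mult_ac)
    qed simp
    finally show ?thesis .
  qed
  \<comment> \<open>The paths of finite length. They have full measure because the expected length
    is finite; off \<open>G\<close> the limit is replaced by the fixed point
    \<open>x0\<close>.\<close>
  define G where "G = {\<omega> \<in> space L. (\<Sum>k. ennreal (D k \<omega>)) \<noteq> \<infinity>}"
  have [measurable]: "G \<in> sets L" unfolding G_def by measurable
  have AE_G: "AE \<omega> in L. \<omega> \<in> G"
  proof -
    have "(\<integral>\<^sup>+\<omega>. (\<Sum>k. ennreal (D k \<omega>)) \<partial>L) \<noteq> \<infinity>"
      using tail[of 0] by (auto simp: top_unique)
    then have "AE \<omega> in L. (\<Sum>k. ennreal (D k \<omega>)) \<noteq> \<infinity>"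
      by (intro nn_integral_PInf_AE) measurable
    then show ?thesis using AE_space by eventually_elim (simp add: G_def)
  qed
  obtain x0 where x0: "x0 \<in> S"
    using L.not_empty XS by (meson ex_in_conv)
  have "\<exists>y. y \<in> S \<and> (if \<omega> \<in> G then (\<lambda>n. d (X n \<omega>) y) \<longlonglongrightarrow> 0 \<and>
           (\<forall>n. ennreal (d (X n \<omega>) y) \<le> (\<Sum>k. ennreal (D (k + n) \<omega>))) else y = x0)"
    if \<omega>: "\<omega> \<in> space L" for \<omega>
  proof (cases "\<omega> \<in> G")
    case True
    then have sm: "summable (\<lambda>k. D k \<omega>)"
      by (intro summable_suminf_not_top) (auto simp: G_def D_def)
    then obtain y where y: "y \<in> S" "(\<lambda>n. d (X n \<omega>) y) \<longlonglongrightarrow> 0"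
      "\<And>n. d (X n \<omega>) y \<le> (\<Sum>k. D (k + n) \<omega>)"
      using summable_dist_limit[OF complete, of "\<lambda>n. X n \<omega>", OF XS[OF \<omega>]]
      by (auto simp: D_def)
    have "ennreal (d (X n \<omega>) y) \<le> (\<Sum>k. ennreal (D (k + n) \<omega>))" for n
    proof -
      have "(\<Sum>k. ennreal (D (k + n) \<omega>)) = ennreal (\<Sum>k. D (k + n) \<omega>)"
        using summable_ignore_initial_segment[OF sm, of n]
        by (intro suminf_ennreal2) (auto simp: D_def)
      then show ?thesis using y(3)[of n] by (simp add: ennreal_leI)
    qed
    then show ?thesis using True y by auto
  qed (use x0 in auto)
  then obtain Y where Y: "\<And>\<omega>. \<omega> \<in> space L \<Longrightarrow> Y \<omega> \<in> S"
    "\<And>\<omega>. \<omega> \<in> space L \<Longrightarrow> if \<omega> \<in> G then (\<lambda>n. d (X n \<omega>) (Y \<omega>)) \<longlonglongrightarrow> 0 \<and>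
           (\<forall>n. ennreal (d (X n \<omega>) (Y \<omega>)) \<le> (\<Sum>k. ennreal (D (k + n) \<omega>))) else Y \<omega> = x0"
    by metis
  \<comment> \<open>\<open>Y\<close> comes from a pointwise choice, so its measurability is not
    built in. Its distance to each \<open>c\<close> is a pointwise limit of measurable functions,
    constant off \<open>G\<close>.\<close>
  have mY[measurable]: "Y \<in> L \<rightarrow>\<^sub>M \<B>"
  proof (rule measurable_borel_ofI_dist)
    fix c assume c: "c \<in> S"
    note [measurable] = dist_measurable1[OF c]
    show "(\<lambda>\<omega>. d c (Y \<omega>)) \<in> borel_measurable L"
    proof (rule borel_measurable_LIMSEQ_real)
      show "(\<lambda>\<omega>. if \<omega> \<in> G then d c (X n \<omega>) else d c x0) \<in> borel_measurable L" for n
        by measurable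
      fix \<omega> assume \<omega>: "\<omega> \<in> space L"
      show "(\<lambda>n. if \<omega> \<in> G then d c (X n \<omega>) else d c x0) \<longlonglongrightarrow> d c (Y \<omega>)"
      proof (cases "\<omega> \<in> G")
        case True
        have lim: "(\<lambda>n. d (X n \<omega>) (Y \<omega>)) \<longlonglongrightarrow> 0" using Y(2)[OF \<omega>] True by simp
        have "(\<lambda>n. d c (X n \<omega>) - d c (Y \<omega>)) \<longlonglongrightarrow> 0"
        proof (rule Lim_null_comparison[OF _ lim])
          show "\<forall>\<^sub>F n in sequentially. norm (d c (X n \<omega>) - d c (Y \<omega>)) \<le> d (X n \<omega>) (Y \<omega>)"
            using mdist_reverse_triangle[OF XS[OF \<omega>] c Y(1)[OF \<omega>]] by (simp add: commute)
        qed
        then show ?thesis using True by (simp add: LIM_zero_iff)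
      qed (use Y(2)[OF \<omega>] in simp)
    qed
  qed (use Y(1) in auto)
  have int: "(\<integral>\<^sup>+\<omega>. ennreal (d (X n \<omega>) (Y \<omega>)) \<partial>L) \<le> ennreal (4 * (1/2)^n)" for n
  proof -
    have "(\<integral>\<^sup>+\<omega>. ennreal (d (X n \<omega>) (Y \<omega>)) \<partial>L) \<le> (\<integral>\<^sup>+\<omega>. (\<Sum>k. ennreal (D (k + n) \<omega>)) \<partial>L)"
    proof (rule nn_integral_mono_AE)
      show "AE \<omega> in L. ennreal (d (X n \<omega>) (Y \<omega>)) \<le> (\<Sum>k. ennreal (D (k + n) \<omega>))"
        using AE_G AE_space
      proof eventually_elim
        case (elim \<omega>)
        then show ?case using Y(2)[of \<omega>] by simp
      qed
    qed
    with tail[of n] show ?thesis by simp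
  qed
  have "distr L \<B> Y \<in> P1 S d"
  proof (rule P1_distr_near[OF L(1) mY X[of 0]])
    show "distr L \<B> (X 0) \<in> P1 S d" by (simp add: lawX \<sigma>)
    have "(\<integral>\<^sup>+\<omega>. ennreal (d (X 0 \<omega>) (Y \<omega>)) \<partial>L) < \<infinity>"
      using int[of 0] by (rule le_less_trans) simp
    then show "(\<integral>\<^sup>+\<omega>. ennreal (d (Y \<omega>) (X 0 \<omega>)) \<partial>L) < \<infinity>"
      by (simp add: commute)
  qed
  moreover have "W1 d (\<sigma> n) (distr L \<B> Y) \<le> 4 * (1/2)^n" for n
    using W1_distr_le[OF L(1) X mY int] by (simp add: lawX)
  ultimately show ?thesis by blast
qed

text \<open>A Cauchy sequence has a subsequence with steps below (1/2)^k, and a limit of a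
  subsequence is a limit of the whole sequence.\<close>

lemma P1_mcomplete:
  assumes complete: "mcomplete"
  shows "Metric_space.mcomplete (P1 S d) (W1 d)"
proof -
  interpret W: Metric_space "P1 S d" "W1 d" by (rule Metric_space_P1)
  show ?thesis
    unfolding W.mcomplete_def
  proof (intro allI impI)
    fix \<sigma> assume \<sigma>: "W.MCauchy \<sigma>"
    have "\<exists>N. \<forall>n n'. N \<le> n \<longrightarrow> N \<le> n' \<longrightarrow> W1 d (\<sigma> n) (\<sigma> n') < (1/2)^k" for k :: nat
      using \<sigma> unfolding W.MCauchy_def by simp
    then obtain N where N: "\<And>k n n'. N k \<le> n \<Longrightarrow> N k \<le> n' \<Longrightarrow> W1 d (\<sigma> n) (\<sigma> n') < (1/2)^(k::nat)"
      by metis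
    have "\<exists>r. \<forall>k. N k \<le> r k \<and> r k < r (Suc k)"
    proof (rule dependent_nat_choice)
      show "\<exists>x. N 0 \<le> x" by blast
      show "\<exists>y. N (Suc k) \<le> y \<and> x < y" for x k
        by (rule exI[of _ "max (N (Suc k)) (Suc x)"]) auto
    qed
    then obtain r where r: "\<And>k. N k \<le> r k" "\<And>k. r k < r (Suc k)" by blast
    have "W1 d (\<sigma> (r k)) (\<sigma> (r (Suc k))) < (1/2)^k" for k
      using r(1)[of k] r(2)[of k] by (intro N) auto
    moreover have "\<sigma> n \<in> P1 S d" for n using \<sigma> by (auto simp: W.MCauchy_def)
    ultimately obtain \<mu> where \<mu>: "\<mu> \<in> P1 S d" "\<And>n. W1 d (\<sigma> (r n)) \<mu> \<le> 4 * (1/2)^n"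
      using P1_convergent_of_summable[OF complete, of "\<lambda>k. \<sigma> (r k)"] by auto
    have "(\<lambda>n. W1 d (\<sigma> (r n)) \<mu>) \<longlonglongrightarrow> 0"
    proof (rule tendsto_sandwich[of "\<lambda>_. 0" _ _ "\<lambda>n. 4 * (1/2)^n"])
      show "(\<lambda>n. 4 * (1/2)^n :: real) \<longlonglongrightarrow> 0"
        by (intro tendsto_mult_right_zero LIMSEQ_power_zero) simp
    qed (use \<mu>(2) in auto)
    then have "limitin W.mtopology (\<sigma> \<circ> r) \<mu> sequentially"
      using \<mu>(1) \<open>\<And>n. \<sigma> n \<in> P1 S d\<close> by (simp add: W.limitin_metric_dist_null comp_def)
    then have "limitin W.mtopology \<sigma> \<mu> sequentially"
      using r(2) by (intro W.MCauchy_convergent_subsequence[OF \<sigma>, of r]) (auto simp: strict_mono_Suc_iff)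
    then show "\<exists>x. limitin W.mtopology \<sigma> x sequentially" by blast
  qed
qed

end

section \<open>Separability\<close>

text \<open>A uniform variable compared with \<open>t\<close> acts as a coin of success probability
  \<open>t\<close>; it decides where a point is moved in the discretisation.\<close>

lemma emeasure_uniform_threshold:
  fixes t :: real
  assumes t: "0 \<le> t" "t \<le> 1"
  shows "emeasure (uniform_measure lborel {0..1}) {u. if u \<le> t then P else Q} =
           ennreal (of_bool P * t + of_bool Q * (1 - t))"
proof -
  have 1: "{0..1} \<inter> {u. u \<le> t} = {0..t}" "{0..1} \<inter> {u. \<not> u \<le> t} = {t<..1}"
    using t by auto
  show ?thesis
    using t by (cases P; cases Q) (simp_all add: 1 divide_ennreal_def)
qed

lemma floor_ratio_tendsto_1:
  fixes w :: real
  assumes "w > 0"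
  shows "(\<lambda>k. of_int \<lfloor>real k * w\<rfloor> / (real k * w)) \<longlonglongrightarrow> 1"
proof (rule tendsto_sandwich)
  have "(\<lambda>k. 1 - inverse w * inverse (real k)) \<longlonglongrightarrow> 1 - inverse w * 0"
    by (intro tendsto_diff tendsto_const tendsto_mult lim_inverse_n)
  then show "(\<lambda>k. 1 - 1 / (real k * w)) \<longlonglongrightarrow> 1"
    by (simp add: field_simps)
  show "\<forall>\<^sub>F k in sequentially. 1 - 1 / (real k * w) \<le> of_int \<lfloor>real k * w\<rfloor> / (real k * w)"
    using eventually_gt_at_top[of 0]
  proof eventually_elim
    case (elim k)
    then have "real k * w > 0" using assms by simp
    moreover have "real k * w - 1 \<le> of_int \<lfloor>real k * w\<rfloor>" by linarith
    ultimately have "(real k * w - 1) / (real k * w) \<le> of_int \<lfloor>real k * w\<rfloor> / (real k * w)"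
      by (intro divide_right_mono) auto
    moreover have "(real k * w - 1) / (real k * w) = 1 - 1 / (real k * w)"
      using \<open>real k * w > 0\<close> by (metis diff_divide_distrib divide_self less_irrefl)
    ultimately show ?case by simp
  qed
  show "\<forall>\<^sub>F k in sequentially. of_int \<lfloor>real k * w\<rfloor> / (real k * w) \<le> 1"
    using assms by (intro always_eventually allI) (auto simp: divide_le_eq_1)
qed simp

context separable_Metric_space
begin

text \<open>Write \<open>w\<^sub>i\<close> for the \<open>\<mu>\<close>-mass of the \<open>i\<close>-th piece of a fine partition. A point of this piece is moved to the
  nearby \<open>q i\<close> with probability \<open>\<lfloor>k w\<^sub>i\<rfloor> / (k w\<^sub>i)\<close> if \<open>i < k\<close>, and otherwise to \<open>q 0\<close>; the resulting
  weights are multiples of \<open>1 / k\<close>.\<close>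

lemma P1_rational_approx:
  assumes \<mu>: "\<mu> \<in> P1 S d" and e: "e > 0"
    and q: "\<And>i. q i \<in> S" "\<And>x e. x \<in> S \<Longrightarrow> e > 0 \<Longrightarrow> \<exists>i. d (q i) x < e"
  shows "\<exists>\<nu>\<in>P1 S d. W1 d \<mu> \<nu> < e \<and> (\<exists>k::nat. \<exists>a::nat list. \<forall>B\<in>sets \<B>. measure \<nu> B =
           indicator B (q 0) + (\<Sum>i<k. real (a ! i) / real k * (indicator B (q i) - indicator B (q 0))))"
proof -
  interpret \<mu>: prob_space \<mu> using P1_D(3)[OF \<mu>] .
  have spm: "space \<mu> = S" and setm: "sets \<mu> = sets \<B>" using P1_D[OF \<mu>] by auto
  obtain idx :: "'a \<Rightarrow> nat" where midx: "idx \<in> \<B> \<rightarrow>\<^sub>M count_space UNIV"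
    and idx: "\<And>x. x \<in> S \<Longrightarrow> d (q (idx x)) x < e / 2"
    using exists_countable_partition[OF _ q, of "e/2"] e by auto
  have [measurable]: "idx \<in> \<mu> \<rightarrow>\<^sub>M count_space UNIV"
    using midx unfolding measurable_cong_sets[OF setm refl] .
  have [measurable]: "q \<in> count_space UNIV \<rightarrow>\<^sub>M \<B>" using q(1) by simp
  have dq0[measurable]: "(\<lambda>x. d (q 0) x) \<in> borel_measurable \<mu>"
    using dist_measurable1[OF q(1)] unfolding measurable_cong_sets[OF setm refl] .
  define w where "w i = measure \<mu> {x \<in> space \<mu>. idx x = i}" for i
  \<comment> \<open>Rounding down keeps the ratio at most 1, so it is a probability. On a null cell
    the quotient is 0/0 = 0.\<close>
  define \<theta> where "\<theta> k i = (if i < k then of_int \<lfloor>real k * w i\<rfloor> / (real k * w i) else 0)" for k i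
  have w0: "w i \<ge> 0" for i by (simp add: w_def)
  have \<theta>: "0 \<le> \<theta> k i" "\<theta> k i \<le> 1" for k i
    using w0[of i] by (auto simp: \<theta>_def divide_le_eq_1)
  have AEw: "AE x in \<mu>. w (idx x) > 0"
  proof -
    have "AE x in \<mu>. \<forall>i. idx x = i \<longrightarrow> w i > 0"
    proof (subst AE_all_countable, intro allI)
      fix i show "AE x in \<mu>. idx x = i \<longrightarrow> w i > 0"
      proof (cases "w i > 0")
        case False
        then have "measure \<mu> {x \<in> space \<mu>. idx x = i} = 0" using w0[of i] unfolding w_def by linarith
        then have "AE x in \<mu>. idx x \<noteq> i"
          by (subst AE_iff_measurable[OF _ refl]) (auto simp: \<mu>.emeasure_eq_measure)
        then show ?thesis by eventually_elim simp
      qed simp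
    qed
    then show ?thesis by eventually_elim simp
  qed
  have int0: "integrable \<mu> (\<lambda>x. d (q 0) x)"
    using P1_finite_moment[OF \<mu> q(1)] by (intro integrableI_nonneg) auto
  \<comment> \<open>Expected cost of sending points to \<open>q 0\<close>. As k grows, truncation
    and rounding disappear together: \<open>\<theta>\<close> tends to 1 on every cell of positive
    mass, and the distance to \<open>q 0\<close> is an integrable dominating function.\<close>
  define c where "c k = (\<integral>x. d (q 0) x * (1 - \<theta> k (idx x)) \<partial>\<mu>)" for k
  have "c \<longlonglongrightarrow> (\<integral>x. 0 \<partial>\<mu>)"
    unfolding c_def[abs_def]
  proof (rule integral_dominated_convergence[where w = "\<lambda>x. d (q 0) x"])
    show "AE x in \<mu>. (\<lambda>k. d (q 0) x * (1 - \<theta> k (idx x))) \<longlonglongrightarrow> 0"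
      using AEw
    proof eventually_elim
      case (elim x)
      have "\<forall>\<^sub>F k in sequentially. of_int \<lfloor>real k * w (idx x)\<rfloor> / (real k * w (idx x)) = \<theta> k (idx x)"
        using eventually_gt_at_top[of "idx x"] by eventually_elim (simp add: \<theta>_def)
      then have "(\<lambda>k. \<theta> k (idx x)) \<longlonglongrightarrow> 1"
        using floor_ratio_tendsto_1[OF elim] by (rule Lim_transform_eventually[rotated])
      then have "(\<lambda>k. d (q 0) x * (1 - \<theta> k (idx x))) \<longlonglongrightarrow> d (q 0) x * (1 - 1)"
        by (intro tendsto_intros)
      then show ?case by simp
    qed
    show "AE x in \<mu>. norm (d (q 0) x * (1 - \<theta> k (idx x))) \<le> d (q 0) x" for k
      using \<theta> by (intro AE_I2) (auto simp: abs_mult intro!: mult_left_le)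
  qed (use int0 in auto)
  \<comment> \<open>One half of \<open>e\<close> is left for \<open>c k\<close>; the other half pays
    for moving a point to the centre of its cell.\<close>
  then have "\<forall>\<^sub>F k in sequentially. c k < e / 2 \<and> k > 0"
    using e by (intro eventually_conj order_tendstoD(2) eventually_gt_at_top) auto
  then obtain k where k: "c k < e / 2" "k > 0"
    using eventually_happens[of _ sequentially] by auto
  have intk: "integrable \<mu> (\<lambda>x. d (q 0) x * (1 - \<theta> k (idx x)))"
    using \<theta> by (intro Bochner_Integration.integrable_bound[OF int0])
      (auto simp: abs_mult intro!: AE_I2 mult_left_le)
  define U where "U = uniform_measure lborel {0..1::real}"
  interpret U: prob_space U
    unfolding U_def by (rule prob_space_uniform_measure) auto
  have [simp]: "space U = UNIV" and sets_U[measurable_cong, simp]: "sets U = sets borel"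
    by (simp_all add: U_def)
  have U1: "emeasure U UNIV = 1" using U.emeasure_space_1 by simp
  interpret L: pair_prob_space \<mu> U ..
  define T where "T p = (if snd p \<le> \<theta> k (idx (fst p)) then q (idx (fst p)) else q 0)" for p
  have mT[measurable]: "T \<in> \<mu> \<Otimes>\<^sub>M U \<rightarrow>\<^sub>M \<B>"
    unfolding T_def[abs_def]
  proof (intro measurable_If measurable_const)
    show "(\<lambda>p. q (idx (fst p))) \<in> \<mu> \<Otimes>\<^sub>M U \<rightarrow>\<^sub>M \<B>" by measurable
    show "{p \<in> space (\<mu> \<Otimes>\<^sub>M U). snd p \<le> \<theta> k (idx (fst p))} \<in> sets (\<mu> \<Otimes>\<^sub>M U)" by measurable
  qed (simp add: q)
  have mfst[measurable]: "fst \<in> \<mu> \<Otimes>\<^sub>M U \<rightarrow>\<^sub>M \<B>"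
    using measurable_fst[of \<mu> U] by (simp add: measurable_cong_sets[OF refl setm])
  let ?\<nu> = "distr (\<mu> \<Otimes>\<^sub>M U) \<B> T"
  have fst: "distr (\<mu> \<Otimes>\<^sub>M U) \<B> fst = \<mu>"
    using U.distr_pair_fst[of \<mu>] setm by (simp cong: distr_cong)
  have cost: "(\<integral>\<^sup>+p. ennreal (d (fst p) (T p)) \<partial>(\<mu> \<Otimes>\<^sub>M U)) \<le> ennreal (e / 2 + c k)"
  proof -
    have "(\<integral>\<^sup>+p. ennreal (d (fst p) (T p)) \<partial>(\<mu> \<Otimes>\<^sub>M U)) = (\<integral>\<^sup>+x. \<integral>\<^sup>+u. ennreal (d x (T (x, u))) \<partial>U \<partial>\<mu>)"
      using U.nn_integral_fst[of "\<lambda>p. ennreal (d (fst p) (T p))" \<mu>] by simp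
    also have "\<dots> \<le> (\<integral>\<^sup>+x. ennreal (e / 2) + ennreal (d (q 0) x * (1 - \<theta> k (idx x))) \<partial>\<mu>)"
    proof (rule nn_integral_mono)
      fix x assume "x \<in> space \<mu>"
      then have x: "x \<in> S" by (simp add: spm)
      let ?R = "{u. if u \<le> \<theta> k (idx x) then False else True}"
      have "(\<integral>\<^sup>+u. ennreal (d x (T (x, u))) \<partial>U) \<le> (\<integral>\<^sup>+u. ennreal (e / 2) + ennreal (d (q 0) x) * indicator ?R u \<partial>U)"
      proof (rule nn_integral_mono)
        fix u :: real
        show "ennreal (d x (T (x, u))) \<le> ennreal (e / 2) + ennreal (d (q 0) x) * indicator ?R u"
        proof (cases "u \<le> \<theta> k (idx x)")
          case True
          then show ?thesis using idx[OF x] by (simp add: T_def commute ennreal_leI)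
        next
          case False
          then show ?thesis by (simp add: T_def commute[of x])
        qed
      qed
      also have "\<dots> = ennreal (e / 2) + ennreal (d (q 0) x) * emeasure U ?R"
        by (subst nn_integral_add) (auto simp: nn_integral_cmult_indicator U1)
      also have "emeasure U ?R = ennreal (1 - \<theta> k (idx x))"
        unfolding U_def by (subst emeasure_uniform_threshold) (use \<theta> in auto)
      finally show "(\<integral>\<^sup>+u. ennreal (d x (T (x, u))) \<partial>U) \<le>
          ennreal (e / 2) + ennreal (d (q 0) x * (1 - \<theta> k (idx x)))"
        using \<theta> by (simp add: ennreal_mult)
    qed
    also have "\<dots> = ennreal (e / 2) + (\<integral>\<^sup>+x. ennreal (d (q 0) x * (1 - \<theta> k (idx x))) \<partial>\<mu>)"
      by (subst nn_integral_add) (auto simp: \<mu>.emeasure_space_1)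
    also have "(\<integral>\<^sup>+x. ennreal (d (q 0) x * (1 - \<theta> k (idx x))) \<partial>\<mu>) = ennreal (c k)"
      unfolding c_def using \<theta> intk by (intro nn_integral_eq_integral) auto
    also have "ennreal (e / 2) + ennreal (c k) = ennreal (e / 2 + c k)"
      using e \<theta> by (intro ennreal_plus[symmetric]) (auto simp: c_def intro!: integral_nonneg)
    finally show ?thesis .
  qed
  have c0: "0 \<le> c k" using \<theta> by (auto simp: c_def intro!: integral_nonneg)
  have "W1 d \<mu> ?\<nu> \<le> e / 2 + c k"
    using W1_distr_le[OF L.prob_space_axioms mfst mT cost] e c0 by (simp add: fst)
  then have "W1 d \<mu> ?\<nu> < e" using k(1) by simp
  moreover have "?\<nu> \<in> P1 S d"
  proof (rule P1_distr_near[OF L.prob_space_axioms mT mfst])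
    show "distr (\<mu> \<Otimes>\<^sub>M U) \<B> fst \<in> P1 S d" by (simp add: fst \<mu>)
    have "(\<integral>\<^sup>+p. ennreal (d (fst p) (T p)) \<partial>(\<mu> \<Otimes>\<^sub>M U)) < \<infinity>"
      using cost by (rule le_less_trans) simp
    then show "(\<integral>\<^sup>+p. ennreal (d (T p) (fst p)) \<partial>(\<mu> \<Otimes>\<^sub>M U)) < \<infinity>"
      by (simp add: commute)
  qed
  moreover have "measure ?\<nu> B = indicator B (q 0) +
      (\<Sum>i<k. real (map (\<lambda>i. nat \<lfloor>real k * w i\<rfloor>) [0..<k] ! i) / real k * (indicator B (q i) - indicator B (q 0)))"
    if B[measurable]: "B \<in> sets \<B>" for B
  proof -
    define h :: "nat \<Rightarrow> real" where "h i = indicator B (q i) - indicator B (q 0)" for i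
    \<comment> \<open>Probability that the image of x lies in \<open>B\<close>, written as a finite
      sum over cells so that it integrates termwise; cells with index at least k contribute nothing,
      since there \<open>\<theta>\<close> is 0.\<close>
    define f where "f x = indicator B (q 0) +
      (\<Sum>i<k. \<theta> k i * h i * indicator {x \<in> space \<mu>. idx x = i} x)" for x
    have ii: "integrable \<mu> (\<lambda>x. \<theta> k i * h i * indicator {x \<in> space \<mu>. idx x = i} x)" for i
      by (intro integrable_mult_right integrable_real_indicator) (auto simp: less_top[symmetric])
    have fi: "integrable \<mu> f"
      unfolding f_def[abs_def] by (intro Bochner_Integration.integrable_add \<mu>.integrable_const
          Bochner_Integration.integrable_sum ii)
    have f_eq: "f x = indicator B (q 0) + \<theta> k (idx x) * h (idx x)" if x: "x \<in> space \<mu>" for x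
    proof -
      have "(\<Sum>i<k. \<theta> k i * h i * indicator {x \<in> space \<mu>. idx x = i} x) =
          (\<Sum>i<k. if i = idx x then \<theta> k i * h i else 0)"
        using x by (intro sum.cong) (auto simp: indicator_def)
      also have "\<dots> = \<theta> k (idx x) * h (idx x)"
        by (simp add: sum.delta \<theta>_def)
      finally show ?thesis by (simp add: f_def)
    qed
    have f0: "0 \<le> f x" if "x \<in> space \<mu>" for x
      using \<theta>[of k "idx x"] by (auto simp: f_eq[OF that] h_def indicator_def)
    have "emeasure ?\<nu> B = emeasure (\<mu> \<Otimes>\<^sub>M U) (T -` B \<inter> space (\<mu> \<Otimes>\<^sub>M U))"
      by (rule emeasure_distr) measurable
    also have "\<dots> = (\<integral>\<^sup>+x. emeasure U (Pair x -` (T -` B \<inter> space (\<mu> \<Otimes>\<^sub>M U))) \<partial>\<mu>)"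
      by (rule U.emeasure_pair_measure_alt) measurable
    also have "\<dots> = (\<integral>\<^sup>+x. ennreal (indicator B (q 0) + \<theta> k (idx x) * h (idx x)) \<partial>\<mu>)"
    proof (rule nn_integral_cong)
      fix x assume x: "x \<in> space \<mu>"
      have "Pair x -` (T -` B \<inter> space (\<mu> \<Otimes>\<^sub>M U)) =
          {u. if u \<le> \<theta> k (idx x) then q (idx x) \<in> B else q 0 \<in> B}"
        using x by (auto simp: T_def space_pair_measure)
      then have "emeasure U (Pair x -` (T -` B \<inter> space (\<mu> \<Otimes>\<^sub>M U))) =
          ennreal (of_bool (q (idx x) \<in> B) * \<theta> k (idx x) + of_bool (q 0 \<in> B) * (1 - \<theta> k (idx x)))"
        unfolding U_def using \<theta> by (simp only: emeasure_uniform_threshold)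
      then show "emeasure U (Pair x -` (T -` B \<inter> space (\<mu> \<Otimes>\<^sub>M U))) =
          ennreal (indicator B (q 0) + \<theta> k (idx x) * h (idx x))"
        by (simp add: h_def indicator_def algebra_simps)
    qed
    also have "\<dots> = (\<integral>\<^sup>+x. ennreal (f x) \<partial>\<mu>)"
      by (intro nn_integral_cong) (simp add: f_eq)
    also have "\<dots> = ennreal (\<integral>x. f x \<partial>\<mu>)"
      using f0 by (intro nn_integral_eq_integral AE_I2 fi)
    finally have "measure ?\<nu> B = (\<integral>x. f x \<partial>\<mu>)"
      using Bochner_Integration.integral_nonneg[of \<mu> f, OF f0] by (simp add: measure_def)
    also have "(\<integral>x. f x \<partial>\<mu>) = indicator B (q 0) + (\<Sum>i<k. \<theta> k i * h i * w i)"
    proof -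
      have "(\<integral>x. f x \<partial>\<mu>) = (\<integral>x. indicator B (q 0) \<partial>\<mu>) +
          (\<Sum>i<k. \<integral>x. \<theta> k i * h i * indicator {x \<in> space \<mu>. idx x = i} x \<partial>\<mu>)"
        unfolding f_def[abs_def]
        by (subst Bochner_Integration.integral_add)
          (simp_all only: Bochner_Integration.integral_sum ii \<mu>.integrable_const
            Bochner_Integration.integrable_sum)
      then show ?thesis by (simp add: w_def \<mu>.prob_space)
    qed
    \<comment> \<open>The factor \<open>w i\<close> cancels the denominator of
      \<open>\<theta> k i\<close> and leaves the integer
      \<open>\<lfloor>real k * w i\<rfloor>\<close> over k; for a null cell both sides are
      0.\<close>
    also have "(\<Sum>i<k. \<theta> k i * h i * w i) =
        (\<Sum>i<k. real (map (\<lambda>i. nat \<lfloor>real k * w i\<rfloor>) [0..<k] ! i) / real k * h i)"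
      using k(2) w0 by (intro sum.cong) (auto simp: \<theta>_def)
    finally show ?thesis by (simp only: h_def)
  qed
  ultimately show ?thesis by blast
qed

text \<open>An approximating measure is determined on Borel sets by a finite code, the number k and
  a list of naturals. The dense set consists of those members of \<open>P1\<close> that have a code,
  so the injection \<open>code\<close> into a countable type makes it countable.\<close>

lemma P1_separable: "separable_space (Metric_space.mtopology (P1 S d) (W1 d))"
proof -
  interpret W: Metric_space "P1 S d" "W1 d" by (rule Metric_space_P1)
  show ?thesis
  proof (cases "S = {}")
    case True
    then have "P1 S d = {}" by (auto simp: P1_def)
    then show ?thesis unfolding separable_space_def W.topspace_mtopology
      by (intro exI[of _ "{}"]) (simp only: closure_of_empty, simp)
  next
    case False
    obtain q :: "nat \<Rightarrow> 'a" where q: "\<And>i. q i \<in> S" "\<And>x e. x \<in> S \<Longrightarrow> e > 0 \<Longrightarrow> \<exists>i. d (q i) x < e"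
      using exists_dense_seq[OF False] by blast
    define Q where "Q \<nu> p \<longleftrightarrow> (\<forall>B\<in>sets \<B>. measure \<nu> B = indicator B (q 0) +
        (\<Sum>i<fst p. real (snd p ! i) / real (fst p) * (indicator B (q i) - indicator B (q 0))))"
      for \<nu> and p :: "nat \<times> nat list"
    define C where "C = {\<nu> \<in> P1 S d. \<exists>p. Q \<nu> p}"
    define code where "code \<nu> = (SOME p. Q \<nu> p)" for \<nu>
    have code: "Q \<nu> (code \<nu>)" if "\<nu> \<in> C" for \<nu>
      using that unfolding C_def code_def by (auto intro: someI)
    have "inj_on code C"
    proof (rule inj_onI)
      fix \<mu> \<nu> assume *: "\<mu> \<in> C" "\<nu> \<in> C" "code \<mu> = code \<nu>"
      then have P: "\<mu> \<in> P1 S d" "\<nu> \<in> P1 S d" by (auto simp: C_def)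
      interpret \<mu>: prob_space \<mu> using P1_D(3)[OF P(1)] .
      interpret \<nu>: prob_space \<nu> using P1_D(3)[OF P(2)] .
      have eq: "measure \<mu> B = measure \<nu> B" if "B \<in> sets \<B>" for B
        using code[OF *(1)] code[OF *(2)] that unfolding *(3) Q_def by simp
      show "\<mu> = \<nu>"
        by (rule measure_eqI) (simp_all add: P1_D(2)[OF P(1)] P1_D(2)[OF P(2)]
            \<mu>.emeasure_eq_measure \<nu>.emeasure_eq_measure eq)
    qed
    then have "countable C"
      by (rule countable_image_inj_on[rotated]) simp
    moreover have "W.mtopology closure_of C = P1 S d"
    proof (intro equalityI subsetI)
      fix \<mu> assume \<mu>: "\<mu> \<in> P1 S d"
      have "\<exists>\<nu>\<in>C. \<nu> \<in> W.mball \<mu> e" if e: "e > 0" for e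
      proof -
        obtain \<nu> k a where "\<nu> \<in> P1 S d" "W1 d \<mu> \<nu> < e" "Q \<nu> (k, a)"
          using P1_rational_approx[OF \<mu> e q] unfolding Q_def fst_conv snd_conv by blast
        then show ?thesis using \<mu> by (intro bexI[of _ \<nu>]) (auto simp: C_def)
      qed
      then show "\<mu> \<in> W.mtopology closure_of C"
        using \<mu> unfolding W.metric_closure_of by blast
    next
      fix \<mu> assume "\<mu> \<in> W.mtopology closure_of C"
      then show "\<mu> \<in> P1 S d" unfolding W.metric_closure_of by blast
    qed
    ultimately show ?thesis
      unfolding separable_space_def W.topspace_mtopology by (intro exI[of _ C]) (auto simp: C_def)
  qed
qed

end

section \<open>Observable diameter\<close>

lemma set_diam_scale_le:
  assumes "C > 0"
  shows "set_diam {t. t / C \<in> A} \<le> ereal C * set_diam A"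
  unfolding set_diam_def[of "{t. t / C \<in> A}"]
proof (intro SUP_least)
  fix x y assume "x \<in> {t. t / C \<in> A}" "y \<in> {t. t / C \<in> A}"
  then have "x / C \<in> A" "y / C \<in> A" by auto
  then have "ereal \<bar>x / C - y / C\<bar> \<le> set_diam A"
    unfolding set_diam_def by (intro SUP_upper2[of "x / C" A] SUP_upper2[of "y / C" A]) auto
  then have "ereal C * ereal \<bar>x / C - y / C\<bar> \<le> ereal C * set_diam A"
    using assms by (intro ereal_mult_left_mono) auto
  moreover have "C * \<bar>x / C - y / C\<bar> = \<bar>x - y\<bar>"
    using assms by (simp add: diff_divide_distrib[symmetric])
  ultimately show "ereal \<bar>x - y\<bar> \<le> ereal C * set_diam A" by simp
qed

lemma partial_diam_scale_le:
  assumes C: "C > 0" and f[measurable]: "f \<in> borel_measurable \<nu>"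
  shows "partial_diam (distr \<nu> borel f) \<alpha> \<le> ereal C * partial_diam (distr \<nu> borel (\<lambda>x. f x / C)) \<alpha>"
proof -
  \<comment> \<open>Dividing by \<open>C\<close> leaves a bare infimum on the right, so each
    competing set \<open>A\<close> can be treated alone; its counterpart for \<open>f\<close> is
    \<open>A\<close> scaled by \<open>C\<close>, of equal mass.\<close>
  have "partial_diam (distr \<nu> borel f) \<alpha> / ereal C \<le> partial_diam (distr \<nu> borel (\<lambda>x. f x / C)) \<alpha>"
    unfolding partial_diam_def[of "distr \<nu> borel (\<lambda>x. f x / C)"]
  proof (rule INF_greatest)
    fix A assume A: "A \<in> {A. A \<in> sets borel \<and> \<alpha> \<le> measure (distr \<nu> borel (\<lambda>x. f x / C)) A}"
    then have [measurable]: "A \<in> sets borel" by simp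
    have "{t \<in> space borel. t / C \<in> A} \<in> sets borel" by measurable
    then have A': "{t. t / C \<in> A} \<in> sets borel" by simp
    have "measure (distr \<nu> borel f) {t. t / C \<in> A} = measure (distr \<nu> borel (\<lambda>x. f x / C)) A"
      using A' by (simp add: measure_distr vimage_def)
    then have "partial_diam (distr \<nu> borel f) \<alpha> \<le> set_diam {t. t / C \<in> A}"
      unfolding partial_diam_def using A A' by (intro INF_lower) auto
    also have "\<dots> \<le> ereal C * set_diam A" by (rule set_diam_scale_le[OF C])
    finally show "partial_diam (distr \<nu> borel f) \<alpha> / ereal C \<le> set_diam A"
      using C by (simp add: ereal_divide_le_pos)
  qed
  then show ?thesis using C by (simp add: ereal_divide_le_pos)
qed

text \<open>The competitor on the source is f composed with \<open>m\<close>, divided by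
  \<open>C\<close>. The two successive push-forwards under \<open>m\<close> and \<open>f\<close>
  merge into one because \<open>f\<close> is measurable, which is what \<open>lip_meas\<close>
  provides.\<close>

lemma obs_diam_lipschitz_image_le:
  assumes C: "C \<ge> 1" and m[measurable]: "m \<in> \<nu> \<rightarrow>\<^sub>M N"
    and lip_meas: "\<And>f. f \<in> lip1_funs S' d' \<Longrightarrow> f \<in> borel_measurable N"
    and m': "\<And>x. x \<in> S \<Longrightarrow> m x \<in> S'"
    and lip: "\<And>x y. x \<in> S \<Longrightarrow> y \<in> S \<Longrightarrow> d' (m x) (m y) \<le> C * d x y"
  shows "obs_diam S' d' (distr \<nu> N m) \<le> ereal C * obs_diam S d \<nu>"
proof -
  have C0: "C > 0" using C by simp
  have kappa: "obs_diam_kappa S' d' (distr \<nu> N m) \<kappa> \<le> ereal C * obs_diam_kappa S d \<nu> \<kappa>" for \<kappa>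
    unfolding obs_diam_kappa_def[of S']
  proof (rule SUP_least)
    fix f assume f: "f \<in> lip1_funs S' d'"
    note [measurable] = lip_meas[OF f]
    have g: "(\<lambda>x. f (m x) / C) \<in> lip1_funs S d"
      unfolding lip1_funs_def
    proof (intro CollectI ballI)
      fix x y assume xy: "x \<in> S" "y \<in> S"
      have "\<bar>f (m x) - f (m y)\<bar> \<le> d' (m x) (m y)"
        using f m' xy by (auto simp: lip1_funs_def)
      also have "\<dots> \<le> C * d x y" using lip xy .
      finally have "\<bar>f (m x) - f (m y)\<bar> / C \<le> d x y"
        using C0 by (simp add: pos_divide_le_eq mult.commute)
      then show "\<bar>f (m x) / C - f (m y) / C\<bar> \<le> d x y"
        using C0 by (simp add: diff_divide_distrib[symmetric])
    qed
    have "distr (distr \<nu> N m) borel f = distr \<nu> borel (\<lambda>x. f (m x))"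
      by (subst distr_distr) (auto simp: comp_def)
    then have "partial_diam (distr (distr \<nu> N m) borel f) (1 - \<kappa>) \<le>
        ereal C * partial_diam (distr \<nu> borel (\<lambda>x. f (m x) / C)) (1 - \<kappa>)"
      using partial_diam_scale_le[OF C0, of "\<lambda>x. f (m x)" \<nu>] by simp
    also have "\<dots> \<le> ereal C * obs_diam_kappa S d \<nu> \<kappa>"
      unfolding obs_diam_kappa_def using C0 g
      by (intro ereal_mult_left_mono SUP_upper2[OF g]) auto
    finally show "partial_diam (distr (distr \<nu> N m) borel f) (1 - \<kappa>) \<le> ereal C * obs_diam_kappa S d \<nu> \<kappa>" .
  qed
  have "obs_diam S' d' (distr \<nu> N m) / ereal C \<le> obs_diam S d \<nu>"
    unfolding obs_diam_def[of S]
  proof (rule INF_greatest)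
    fix \<kappa> :: real assume \<kappa>: "\<kappa> \<in> {0<..<1}"
    let ?M = "max (obs_diam_kappa S d \<nu> \<kappa>) (ereal \<kappa>)"
    have "obs_diam S' d' (distr \<nu> N m) \<le> max (obs_diam_kappa S' d' (distr \<nu> N m) \<kappa>) (ereal \<kappa>)"
      unfolding obs_diam_def using \<kappa> by (rule INF_lower)
    also have "\<dots> \<le> ereal C * ?M"
    proof (rule max.boundedI)
      show "obs_diam_kappa S' d' (distr \<nu> N m) \<kappa> \<le> ereal C * ?M"
        by (rule order_trans[OF kappa ereal_mult_left_mono]) (use C0 in auto)
      have "ereal \<kappa> \<le> ereal (C * \<kappa>)"
        using \<kappa> C by simp
      also have "\<dots> = ereal C * ereal \<kappa>" by simp
      also have "\<dots> \<le> ereal C * ?M" using C0 by (intro ereal_mult_left_mono) auto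
      finally show "ereal \<kappa> \<le> ereal C * ?M" .
    qed
    finally show "obs_diam S' d' (distr \<nu> N m) / ereal C \<le> ?M"
      using C0 by (simp add: ereal_divide_le_pos)
  qed
  then show ?thesis using C0 by (simp add: ereal_divide_le_pos)
qed

section \<open>The law of a random walk as a measure on \<open>P1\<close>\<close>

lemma obs_diam_nonneg: "0 \<le> obs_diam S d \<mu>"
  unfolding obs_diam_def by (intro INF_greatest) (auto simp: le_max_iff_disj)

lemma mm_space_P1_pushforward:
  assumes "mm_space S d \<nu>" "random_walk S d \<nu> m"
  shows "mm_space (P1 S d) (W1 d) (pushforward_walk S d \<nu> m)"
proof -
  interpret Metric_space S d using assms(1) by (simp add: mm_space_def)
  interpret separable_Metric_space S d
    by unfold_locales (use assms(1) in \<open>simp add: mm_space_def\<close>)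
  interpret W: Metric_space "P1 S d" "W1 d" by (rule Metric_space_P1)
  have "mcomplete" "prob_space \<nu>" using assms(1) by (simp_all add: mm_space_def)
  moreover have "m \<in> \<nu> \<rightarrow>\<^sub>M P1_borel S d" using assms(2) by (simp add: random_walk_def)
  ultimately show ?thesis
    unfolding mm_space_def pushforward_walk_def
    using Metric_space_P1 P1_mcomplete P1_separable prob_space.prob_space_distr
    by (auto simp: P1_borel_def)
qed

lemma obs_diam_pushforward_walk_le:
  assumes mm: "mm_space S d \<nu>" and walk: "random_walk S d \<nu> m"
    and curv: "\<And>x y. x \<in> S \<Longrightarrow> y \<in> S \<Longrightarrow> x \<noteq> y \<Longrightarrow> coarse_ricci1 d m x y \<ge> \<kappa>0"
  shows "obs_diam (P1 S d) (W1 d) (pushforward_walk S d \<nu> m) \<le> ereal (max 1 (1 - \<kappa>0)) * obs_diam S d \<nu>"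
  unfolding pushforward_walk_def
proof (rule obs_diam_lipschitz_image_le)
  interpret Metric_space S d using mm by (simp add: mm_space_def)
  interpret separable_Metric_space S d
    by unfold_locales (use mm in \<open>simp add: mm_space_def\<close>)
  interpret W: Metric_space "P1 S d" "W1 d" by (rule Metric_space_P1)
  show "m \<in> \<nu> \<rightarrow>\<^sub>M P1_borel S d" using walk by (simp add: random_walk_def)
  show mP: "m x \<in> P1 S d" if "x \<in> S" for x using walk that by (simp add: random_walk_def)
  show "f \<in> borel_measurable (P1_borel S d)" if "f \<in> lip1_funs (P1 S d) (W1 d)" for f
    unfolding P1_borel_def using that
    by (intro W.lipschitz_borel_measurable[where C = 1]) (auto simp: lip1_funs_def)
  show "W1 d (m x) (m y) \<le> max 1 (1 - \<kappa>0) * d x y" if xy: "x \<in> S" "y \<in> S" for x y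
  \<comment> \<open>Curvature is bounded only for distinct points, where dividing by the distance is
    meaningful; on the diagonal both sides are 0.\<close>
  proof (cases "x = y")
    case True
    then show ?thesis using W1_self[OF mP] xy by simp
  next
    case False
    then have pos: "d x y > 0" using xy by simp
    have "W1 d (m x) (m y) / d x y \<le> 1 - \<kappa>0"
      using curv[OF xy False] by (simp add: coarse_ricci1_def)
    then have "W1 d (m x) (m y) \<le> (1 - \<kappa>0) * d x y"
      using pos by (simp add: pos_divide_le_eq)
    also have "\<dots> \<le> max 1 (1 - \<kappa>0) * d x y"
      by (intro mult_right_mono) auto
    finally show ?thesis .
  qed
qed simp

theorem theorem1p5:
  fixes X :: "nat \<Rightarrow> 'a set" and d :: "nat \<Rightarrow> 'a \<Rightarrow> 'a \<Rightarrow> real"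
    and \<nu> :: "nat \<Rightarrow> 'a measure" and m :: "nat \<Rightarrow> 'a \<Rightarrow> 'a measure" and \<kappa>0 :: real
  assumes levy: "levy_family X d \<nu>"
    and walks: "\<And>n. random_walk (X n) (d n) (\<nu> n) (m n)"
    and curv: "\<And>n x y. x \<in> X n \<Longrightarrow> y \<in> X n \<Longrightarrow> x \<noteq> y \<Longrightarrow> coarse_ricci1 (d n) (m n) x y \<ge> \<kappa>0"
  shows "levy_family (\<lambda>n. P1 (X n) (d n)) (\<lambda>n. W1 (d n))
           (\<lambda>n. pushforward_walk (X n) (d n) (\<nu> n) (m n))"
  unfolding levy_family_def
proof (intro conjI allI)
  have mm: "mm_space (X n) (d n) (\<nu> n)" for n using levy by (simp add: levy_family_def)
  show "mm_space (P1 (X n) (d n)) (W1 (d n)) (pushforward_walk (X n) (d n) (\<nu> n) (m n))" for n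
    by (rule mm_space_P1_pushforward[OF mm walks])
  let ?C = "ereal (max 1 (1 - \<kappa>0))"
  have "(\<lambda>n. ?C * obs_diam (X n) (d n) (\<nu> n)) \<longlonglongrightarrow> ?C * 0"
    by (rule tendsto_cmult_ereal) (use levy in \<open>simp_all add: levy_family_def del: ereal_max\<close>)
  then have lim: "(\<lambda>n. ?C * obs_diam (X n) (d n) (\<nu> n)) \<longlonglongrightarrow> 0" by simp
  show "(\<lambda>n. obs_diam (P1 (X n) (d n)) (W1 (d n)) (pushforward_walk (X n) (d n) (\<nu> n) (m n))) \<longlonglongrightarrow> 0"
  proof (rule tendsto_sandwich[OF _ _ tendsto_const lim])
    show "\<forall>\<^sub>F n in sequentially. obs_diam (P1 (X n) (d n)) (W1 (d n)) (pushforward_walk (X n) (d n) (\<nu> n) (m n))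
        \<le> ?C * obs_diam (X n) (d n) (\<nu> n)"
      by (intro always_eventually allI obs_diam_pushforward_walk_le[OF mm walks curv])
  qed (simp add: obs_diam_nonneg)
qed

end
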